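(* Let $N\ge 1$ and let $W:\mathbb{R}^N\to\mathbb{R}$ satisfy (NL0), (NL1), (NL2), (NL-RAD) and (NL-CONF). Let $\rho_0$ be a compactly supported Borel probability measure on $\mathbb{R}^N$. Then there exists $\bar R>0$, depending only on $\rho_0$ and $W$, such that the weak measure (gradient flow) solution $\rho(t)$, $t\ge 0$, in $\mathcal{P}_2(\mathbb{R}^N)$ of $$\rho_t=\nabla\cdot\big(\rho(\nabla W*\rho)\big),\qquad x\in\mathbb{R}^N,\ t>0,$$ with $\rho(0)=\rho_0$ satisfies $\operatorname{supp}\rho(t)\subset B(0,\bar R)$ for all $t\ge 0$.
   Context: $B(0,r)$ is the ball of radius $r$ centered at $0$ in $\mathbb{R}^N$, and $\mathcal{P}_2(\mathbb{R}^N)$ is the space of Borel probability measures with finite second moment, endowed with the quadratic Wasserstein distance. The assumptions on $W$ are: (NL0) $W\in C(\mathbb{R}^N)\cap C^1(\mathbb{R}^N\setminus\{0\})$, $W(x)=W(-x)$, and $W(0)=0$. (NL1) $W$ is $\lambda$-convex for a certain $\lambda\in\mathbb{R}$, i.e. $W(x)-\frac{\lambda}{2}|x|^2$ is convex. (NL2) There exists a constant $C>0$ such that $W(z)\le C(1+|z|^2)$ for all $z\in\mathbb{R}^N$. (NL-RAD) $W$ is radial, i.e. $W(x)=w(|x|)$, and there exists $R_a\ge 0$ such that $w'(r)\ge 0$ for all $r\ge R_a$ (with $r>0$). (NL-CONF) $\lim_{r\to\infty} w'(r)\,r=+\infty$. Notion of solution: a locally absolutely continuous curve $t\in[0,\infty)\mapsto\rho(t)\in\mathcal{P}_2(\mathbb{R}^N)$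 satisfying $\partial_t\rho+\nabla\cdot(\rho v)=0$ in the sense of distributions on $(0,\infty)\times\mathbb{R}^N$, where $v(t,x)=-\int_{y\ne x}\nabla W(x-y)\,d\rho(t)(y)$ and $t\mapsto\|v(t,\cdot)\|_{L^2(\rho(t))}$ belongs to $L^2_{loc}([0,\infty))$. Under (NL0)-(NL2) it is known that for each $\rho_0\in\mathcal{P}_2(\mathbb{R}^N)$ there is a unique such solution with $\rho(0)=\rho_0$; it is the gradient flow in $\mathcal{P}_2(\mathbb{R}^N)$ of the energy $E[\rho]=\frac12\iint W(x-y)\,d\rho(x)\,d\rho(y)$. *)

theory Defs
  imports "HOL-Probability.Probability"
begin

definition grad :: "('a::euclidean_space \<Rightarrow> real) \<Rightarrow> 'a \<Rightarrow> 'a" where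
  "grad f x = (THE D. GDERIV f x :> D)"

primrec C_k :: "nat \<Rightarrow> ('a::euclidean_space \<Rightarrow> real) \<Rightarrow> bool" where
  "C_k 0 f \<longleftrightarrow> continuous_on UNIV f"
| "C_k (Suc k) f \<longleftrightarrow> (\<forall>x. f differentiable (at x)) \<and>
     (\<forall>b\<in>Basis. C_k k (\<lambda>x. frechet_derivative f (at x) b))"

definition C_infinity :: "('a::euclidean_space \<Rightarrow> real) \<Rightarrow> bool" where
  "C_infinity f \<longleftrightarrow> (\<forall>k. C_k k f)"

definition test_functions :: "(real \<times> 'a::euclidean_space \<Rightarrow> real) set" where
  "test_functions = {\<phi>. C_infinity \<phi> \<and> compact (closure {z. \<phi> z \<noteq> 0}) \<and>
     closure {z. \<phi> z \<noteq> 0} \<subseteq> {0<..} \<times> UNIV}"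

definition borel_prob :: "'a::euclidean_space measure set" where
  "borel_prob = {\<mu>. prob_space \<mu> \<and> sets \<mu> = sets borel}"

definition P2 :: "'a::euclidean_space measure set" where
  "P2 = {\<mu> \<in> borel_prob. integrable \<mu> (\<lambda>x. (norm x)\<^sup>2)}"

definition supp :: "'a::euclidean_space measure \<Rightarrow> 'a set" where
  "supp \<mu> = {x. \<forall>U. open U \<and> x \<in> U \<longrightarrow> emeasure \<mu> U > 0}"

definition couplings ::
    "'a::euclidean_space measure \<Rightarrow> 'a measure \<Rightarrow> ('a \<times> 'a) measure set" where
  "couplings \<mu> \<nu> = {\<gamma> \<in> borel_prob. distr \<gamma> borel fst = \<mu> \<and> distr \<gamma> borel snd = \<nu>}"

definition W2 :: "'a::euclidean_space measure \<Rightarrow> 'a measure \<Rightarrow> real" where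
  "W2 \<mu> \<nu> = sqrt (enn2real
     (INF \<gamma>\<in>couplings \<mu> \<nu>. \<integral>\<^sup>+ (x, y). ennreal ((dist x y)\<^sup>2) \<partial>\<gamma>))"

text \<open>Absolute continuity of curves in a metric space is meant in the sense of
  Ambrosio, Gigli and Savare: the distance of two points of the curve is controlled by the
  integral of a function that is integrable on bounded intervals.\<close>

definition locally_AC_curve :: "(real \<Rightarrow> 'a::euclidean_space measure) \<Rightarrow> bool" where
  "locally_AC_curve \<rho> \<longleftrightarrow> (\<forall>t\<ge>0. \<rho> t \<in> P2) \<and>
     (\<exists>m::real \<Rightarrow> real. (\<forall>T\<ge>0. set_integrable lborel {0..T} m) \<and>
        (\<forall>s t. 0 \<le> s \<longrightarrow> s \<le> t \<longrightarrow> W2 (\<rho> s) (\<rho> t) \<le> (LINT r:{s..t}|lborel. m r)))"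

definition NL0 :: "('a::euclidean_space \<Rightarrow> real) \<Rightarrow> bool" where
  "NL0 W \<longleftrightarrow> continuous_on UNIV W \<and>
     (\<forall>x. x \<noteq> 0 \<longrightarrow> W differentiable (at x)) \<and> continuous_on (- {0}) (grad W) \<and>
     (\<forall>x. W x = W (- x)) \<and> W 0 = 0"

definition NL1 :: "('a::euclidean_space \<Rightarrow> real) \<Rightarrow> bool" where
  "NL1 W \<longleftrightarrow> (\<exists>l::real. convex_on UNIV (\<lambda>x. W x - l / 2 * (norm x)\<^sup>2))"

definition NL2 :: "('a::euclidean_space \<Rightarrow> real) \<Rightarrow> bool" where
  "NL2 W \<longleftrightarrow> (\<exists>C>0. \<forall>z. W z \<le> C * (1 + (norm z)\<^sup>2))"

text \<open>Only the values of the radial profile \<open>w\<close> on \<open>[0, \<infinity>)\<close> matter below, and there it is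
  determined by \<open>W\<close>.\<close>

definition NL_RAD :: "('a::euclidean_space \<Rightarrow> real) \<Rightarrow> (real \<Rightarrow> real) \<Rightarrow> bool" where
  "NL_RAD W w \<longleftrightarrow> (\<forall>x. W x = w (norm x)) \<and>
     (\<exists>R\<^sub>a\<ge>0. \<forall>r. R\<^sub>a \<le> r \<and> 0 < r \<longrightarrow> 0 \<le> deriv w r)"

definition NL_CONF :: "(real \<Rightarrow> real) \<Rightarrow> bool" where
  "NL_CONF w \<longleftrightarrow> filterlim (\<lambda>r. deriv w r * r) at_top at_top"

definition velocity :: "('a::euclidean_space \<Rightarrow> real) \<Rightarrow> 'a measure \<Rightarrow> 'a \<Rightarrow> 'a" where
  "velocity W \<mu> x = - (LINT y:- {x}|\<mu>. grad W (x - y))"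

text \<open>Distributional form of \<open>\<partial>\<^sub>t \<rho> + \<nabla> \<cdot> (\<rho> v) = 0\<close>. Integrability is required explicitly because
  the Bochner integral of a non-integrable function is \<open>0\<close>.\<close>

definition continuity_equation ::
    "(real \<Rightarrow> 'a::euclidean_space measure) \<Rightarrow> (real \<Rightarrow> 'a \<Rightarrow> 'a) \<Rightarrow> bool" where
  "continuity_equation \<rho> v \<longleftrightarrow> (\<forall>\<phi>\<in>test_functions.
     let I = (\<lambda>t. LINT x|\<rho> t. deriv (\<lambda>s. \<phi> (s, x)) t + grad (\<lambda>y. \<phi> (t, y)) x \<bullet> v t x)
     in set_integrable lborel {0<..} I \<and> (LINT t:{0<..}|lborel. I t) = 0)"

definition L2_norm_sq :: "'a::euclidean_space measure \<Rightarrow> ('a \<Rightarrow> 'a) \<Rightarrow> ennreal" where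
  "L2_norm_sq \<mu> u = (\<integral>\<^sup>+ x. ennreal ((norm (u x))\<^sup>2) \<partial>\<mu>)"

definition weak_solution ::
    "('a::euclidean_space \<Rightarrow> real) \<Rightarrow> 'a measure \<Rightarrow> (real \<Rightarrow> 'a measure) \<Rightarrow> bool" where
  "weak_solution W \<rho>\<^sub>0 \<rho> \<longleftrightarrow>
     locally_AC_curve \<rho> \<and>
     continuity_equation \<rho> (\<lambda>t. velocity W (\<rho> t)) \<and>
     (\<lambda>t. L2_norm_sq (\<rho> t) (velocity W (\<rho> t))) \<in> borel_measurable (restrict_space lborel {0..}) \<and>
     (\<forall>T\<ge>0. (\<integral>\<^sup>+ t\<in>{0..T}. L2_norm_sq (\<rho> t) (velocity W (\<rho> t)) \<partial>lborel) < \<infinity>) \<and>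
     \<rho> 0 = \<rho>\<^sub>0"

end

theory Submission
  imports Defs
begin

text \<open>The gradient of the potential is a radial force \<open>G z = c (norm z) *\<^sub>R z\<close> with
  \<open>c r = w' r / r\<close>. Convexity up to a quadratic bounds \<open>c\<close> from below, so repulsion, which occurs
  only at distances below \<open>R\<^sub>a\<close>, is bounded, while the confinement hypothesis says that
  \<open>r\<^sup>2 * c r\<close> exceeds every constant at large distances. At distance \<open>r\<close> from the origin the
  attraction towards the bulk of the mass may be as weak as \<open>M / r\<close>; it could be beaten by the
  repulsion from close neighbours, unless there are few of them. The proof therefore first shows
  that little mass is far out.

  The tool for this is the fourth moment. By symmetry its time derivative is
  \<open>- 2\<close> times the double integral of
  \<open>((norm x)\<^sup>2 *\<^sub>R x - (norm y)\<^sup>2 *\<^sub>R y) \<bullet> G (x - y)\<close>. The repulsive pairs contribute at most a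
  constant times the second moment; the pairs at distance at least \<open>K\<close> contribute, with a factor \<open>M\<close>
  that is as large as desired, the double integral of \<open>(norm (x - y))\<^sup>2\<close>, which is twice the second
  moment up to the conserved center of mass (\<open>quartic_interaction_bound\<close>,
  \<open>quartic_dissipation\<close>). Hence the fourth moment can grow only while the second moment is below a
  constant \<open>C0\<close>. If the measures live in the ball of radius \<open>R\<close>, the second moment is at least the
  fourth one divided by \<open>R\<^sup>2\<close>, and so the fourth moment stays of order \<open>R\<^sup>2\<close>
  (\<open>fourth_moment_bound\<close>).

  Suppose now that the measures live in the ball of radius \<open>2 * r\<close>. By Chebyshev's inequality the mass
  beyond \<open>r / 2\<close> is of order \<open>1 / r\<^sup>2\<close>, and since forces grow at most linearly, this mass adds only a
  bounded amount to \<open>x \<bullet> v\<close> in the shell between \<open>r\<close> and \<open>2 * r\<close>. The rest of the mass is at least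
  \<open>r / 2\<close> away and pulls inwards by more than this amount if \<open>r\<close> is large
  (\<open>field_points_inward\<close>). No mass enters the shell, so the measures live in the ball of radius \<open>r\<close>
  (\<open>support_halving\<close>). On each bounded time interval the linear growth of the velocity gives some
  radius to start from (\<open>finite_propagation\<close>), and halving it repeatedly leads to a radius that does not
  depend on the interval (\<open>uniform_support_bound\<close>).

  Every statement about the evolution follows from one consequence of the distributional
  equation: if a smooth function has nonnegative derivative along the flow, on average, then its
  integral does not decrease (\<open>continuity_equation_monotone\<close>).\<close>

section \<open>Calculus of smooth functions\<close>

lemma C_k_SucI:
  fixes f :: "'a::euclidean_space \<Rightarrow> real"
  assumes "\<And>x. (f has_derivative f' x) (at x)" and "\<And>b. b \<in> Basis \<Longrightarrow> C_k k (\<lambda>x. f' x b)"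
  shows "C_k (Suc k) f"
proof -
  have "frechet_derivative f (at x) = f' x" for x
    using frechet_derivative_at[OF assms(1)] by simp
  then show ?thesis
    using assms by (auto simp: differentiable_def)
qed

lemma C_k_has_derivative:
  assumes "C_k (Suc k) f"
  shows "(f has_derivative frechet_derivative f (at x)) (at x)"
  using assms by (simp add: frechet_derivative_works[symmetric])

lemma C_k_SucD: "C_k (Suc k) f \<Longrightarrow> C_k k f"
proof (induction k arbitrary: f)
  case 0
  then show ?case
    by (auto intro!: differentiable_imp_continuous_on simp: differentiable_on_def
        differentiable_at_withinI)
next
  case (Suc k)
  then show ?case by (metis C_k.simps(2))
qed

lemma C_k_const: "C_k k (\<lambda>x. c)"
  by (induction k arbitrary: c) (auto intro!: C_k_SucI[where f' = "\<lambda>x h. 0"])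

lemma C_k_bounded_linear: "bounded_linear f \<Longrightarrow> C_k k f"
  by (cases k) (auto intro!: C_k_SucI[where f' = "\<lambda>x. f"] C_k_const bounded_linear_imp_has_derivative
      linear_continuous_on simp del: C_k.simps(2))

lemma C_k_add: "C_k k f \<Longrightarrow> C_k k g \<Longrightarrow> C_k k (\<lambda>x. f x + g x)"
proof (induction k arbitrary: f g)
  case 0
  then show ?case by (auto intro: continuous_intros)
next
  case (Suc k)
  show ?case
    by (rule C_k_SucI, rule has_derivative_add[OF Suc.prems[THEN C_k_has_derivative]])
      (use Suc in auto)
qed

lemma C_k_mult: "C_k k f \<Longrightarrow> C_k k g \<Longrightarrow> C_k k (\<lambda>x. f x * g x)"
proof (induction k arbitrary: f g)
  case 0
  then show ?case by (auto intro: continuous_intros)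
next
  case (Suc k)
  have fg: "C_k k f" "C_k k g" using Suc.prems by (auto dest: C_k_SucD simp del: C_k.simps)
  show ?case
    by (rule C_k_SucI, rule has_derivative_mult[OF Suc.prems[THEN C_k_has_derivative]])
      (use Suc fg in \<open>auto intro!: C_k_add\<close>)
qed

lemma C_k_compose:
  fixes h :: "real \<Rightarrow> real"
  shows "C_k k h \<Longrightarrow> C_k k g \<Longrightarrow> C_k k (\<lambda>x. h (g x))"
proof (induction k arbitrary: h g)
  case 0
  then show ?case by (auto intro: continuous_on_compose2)
next
  case (Suc k)
  have g: "C_k k g" using Suc.prems by (auto dest: C_k_SucD simp del: C_k.simps)
  let ?h = "\<lambda>x. frechet_derivative h (at x)" and ?g = "\<lambda>x. frechet_derivative g (at x)"
  have lin: "?h y z = ?h y 1 * z" for y z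
  proof -
    have "linear (?h y)"
      using C_k_has_derivative[OF Suc.prems(1)] has_derivative_linear by blast
    then show ?thesis
      using linear_scale[of "?h y" z 1] by (simp add: mult.commute)
  qed
  have "((\<lambda>x. h (g x)) has_derivative (\<lambda>v. ?h (g x) 1 * ?g x v)) (at x)" for x
    using has_derivative_compose[OF C_k_has_derivative[OF Suc.prems(2)]
        C_k_has_derivative[OF Suc.prems(1)]] lin by (metis (no_types, lifting) ext)
  moreover have "C_k k (\<lambda>x. ?h (g x) 1 * ?g x b)" if "b \<in> Basis" for b
    using Suc g that by (auto intro!: C_k_mult)
  ultimately show ?case
    by (rule C_k_SucI)
qed

lemma C_k_inner:
  fixes f :: "'a::euclidean_space \<Rightarrow> 'b::euclidean_space"
  assumes "bounded_linear f"
  shows "C_k k (\<lambda>x. f x \<bullet> f x)"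
proof (cases k)
  case 0
  then show ?thesis
    using linear_continuous_on[OF assms] by (auto intro: continuous_on_inner)
next
  case (Suc j)
  have "((\<lambda>x. f x \<bullet> f x) has_derivative (\<lambda>v. 2 * (f x \<bullet> f v))) (at x)" for x
    by (rule has_derivative_eq_rhs,
        rule has_derivative_inner[OF bounded_linear_imp_has_derivative[OF assms]
        bounded_linear_imp_has_derivative[OF assms]])
      (simp add: inner_commute fun_eq_iff)
  moreover have "C_k j (\<lambda>x. 2 * (f x \<bullet> f b))" for b
    by (intro C_k_mult C_k_const C_k_bounded_linear bounded_linear_compose[OF _ assms]
        bounded_linear_inner_left)
  ultimately show ?thesis
    unfolding Suc by (rule C_k_SucI)
qed

lemma C_k_exp: "C_k k (exp :: real \<Rightarrow> real)"
proof (induction k)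
  case (Suc k)
  show ?case
    by (rule C_k_SucI[where f' = "\<lambda>x v. v * exp x"])
      (use Suc in \<open>auto intro!: derivative_eq_intros\<close>)
qed (auto intro: continuous_intros)

lemma C_infinity_const: "C_infinity (\<lambda>x. c)"
  by (simp add: C_infinity_def C_k_const)

lemma C_infinity_bounded_linear: "bounded_linear f \<Longrightarrow> C_infinity f"
  by (simp add: C_infinity_def C_k_bounded_linear)

lemma C_infinity_add: "C_infinity f \<Longrightarrow> C_infinity g \<Longrightarrow> C_infinity (\<lambda>x. f x + g x)"
  by (simp add: C_infinity_def C_k_add)

lemma C_infinity_mult: "C_infinity f \<Longrightarrow> C_infinity g \<Longrightarrow> C_infinity (\<lambda>x. f x * g x)"
  by (simp add: C_infinity_def C_k_mult)

lemma C_infinity_minus: "C_infinity f \<Longrightarrow> C_infinity (\<lambda>x. - f x)"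
  using C_infinity_mult[OF C_infinity_const[of "-1"]] by simp

lemma C_infinity_diff: "C_infinity f \<Longrightarrow> C_infinity g \<Longrightarrow> C_infinity (\<lambda>x. f x - g x)"
  using C_infinity_add[OF _ C_infinity_minus] by simp

lemma C_infinity_compose:
  fixes h :: "real \<Rightarrow> real"
  shows "C_infinity h \<Longrightarrow> C_infinity g \<Longrightarrow> C_infinity (\<lambda>x. h (g x))"
  by (simp add: C_infinity_def C_k_compose)

lemma C_infinity_inner:
  fixes f :: "'a::euclidean_space \<Rightarrow> 'b::euclidean_space"
  shows "bounded_linear f \<Longrightarrow> C_infinity (\<lambda>x. f x \<bullet> f x)"
  by (simp add: C_infinity_def C_k_inner)

lemma C_infinity_exp: "C_infinity (exp :: real \<Rightarrow> real)"
  by (simp add: C_infinity_def C_k_exp)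

lemma C_infinity_fst: "C_infinity f \<Longrightarrow> C_infinity (\<lambda>z :: real \<times> 'a::euclidean_space. f (fst z))"
  by (rule C_infinity_compose) (auto intro: C_infinity_bounded_linear bounded_linear_fst)

lemma C_infinity_snd:
  fixes F :: "'a::euclidean_space \<Rightarrow> real"
  assumes "C_infinity F"
  shows "C_infinity (\<lambda>z :: real \<times> 'a. F (snd z))"
proof -
  have "C_k k F \<Longrightarrow> C_k k (\<lambda>z :: real \<times> 'a. F (snd z))" for k
  proof (induction k arbitrary: F)
    case 0
    then have "continuous_on UNIV F" by simp
    from continuous_on_compose2[OF this continuous_on_snd[OF continuous_on_id]]
    show ?case by simp
  next
    case (Suc k)
    show ?case
    proof (rule C_k_SucI)
      show "((\<lambda>z :: real \<times> 'a. F (snd z)) has_derivative (\<lambda>h. frechet_derivative F (at (snd z)) (snd h))) (at z)" for z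
        by (rule has_derivative_compose[where f = snd and f' = snd and g = F])
          (use C_k_has_derivative[OF Suc.prems] in \<open>auto intro: bounded_linear_imp_has_derivative bounded_linear_snd\<close>)
      fix b :: "real \<times> 'a" assume "b \<in> Basis"
      then have "snd b = 0 \<or> snd b \<in> Basis" by (auto simp: Basis_prod_def)
      then show "C_k k (\<lambda>z :: real \<times> 'a. frechet_derivative F (at (snd z)) (snd b))"
      proof
        assume "snd b = 0"
        then have "frechet_derivative F (at x) (snd b) = 0" for x
          using has_derivative_linear[OF C_k_has_derivative[OF Suc.prems]] linear_0 by metis
        then show ?thesis by (simp add: C_k_const)
      next
        assume "snd b \<in> Basis"
        then show ?thesis
          using Suc.IH[of "\<lambda>x. frechet_derivative F (at x) (snd b)"] Suc.prems by simp
      qed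
    qed
  qed
  then show ?thesis using assms by (simp add: C_infinity_def)
qed

lemma C_infinity_derivative:
  assumes "C_infinity f"
  shows "\<And>x. (f has_derivative frechet_derivative f (at x)) (at x)"
    and "\<And>v. continuous_on UNIV (\<lambda>x. frechet_derivative f (at x) v)"
    and "continuous_on UNIV f"
proof -
  have 1: "C_k (Suc 0) f" and 0: "C_k 0 f" using assms unfolding C_infinity_def by blast+
  show d: "(f has_derivative frechet_derivative f (at x)) (at x)" for x
    using 1 by (rule C_k_has_derivative)
  show "continuous_on UNIV f" using 0 by simp
  fix v
  have "frechet_derivative f (at x) v = (\<Sum>b\<in>Basis. (v \<bullet> b) * frechet_derivative f (at x) b)" for x
  proof -
    have "linear (frechet_derivative f (at x))" using d has_derivative_linear by blast
    then show ?thesis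
      using Linear_Algebra.linear_componentwise[of "frechet_derivative f (at x)" v 1]
      by simp
  qed
  then show "continuous_on UNIV (\<lambda>x. frechet_derivative f (at x) v)"
    using 1 by (auto intro!: continuous_intros)
qed

section \<open>A smooth step function\<close>

text \<open>The functions \<open>p (1 / x) * exp (- 1 / x)\<close>, extended by zero, form a family that is closed under
  differentiation. Proving differentiability for all polynomials \<open>p\<close> at once makes smoothness of the
  single function \<open>exp (- 1 / x)\<close> an immediate induction.\<close>

definition flat :: "real poly \<Rightarrow> real \<Rightarrow> real" where
  "flat p x = (if x \<le> 0 then 0 else poly p (1 / x) * exp (- (1 / x)))"

lemma flat_tendsto_0: "((\<lambda>x. flat p x) \<longlongrightarrow> 0) (at 0)"
proof -
  have u: "((\<lambda>u. poly p u * exp (- u)) \<longlongrightarrow> 0) at_top"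
  proof -
    have "((\<lambda>u. \<Sum>i\<le>degree p. coeff p i * (u ^ i / exp u)) \<longlongrightarrow> (\<Sum>i\<le>degree p. coeff p i * 0)) at_top"
      by (intro tendsto_intros tendsto_power_div_exp_0)
    moreover have "(\<Sum>i\<le>degree p. coeff p i * (u ^ i / exp u)) = poly p u * exp (- u)" for u
      by (simp only: poly_altdef sum_distrib_right) (simp add: exp_minus divide_simps)
    ultimately show ?thesis by simp
  qed
  have "filterlim (\<lambda>x::real. 1 / x) at_top (at_right 0)"
    by (simp add: filterlim_inverse_at_top_right divide_inverse)
  from filterlim_compose[OF u this]
  have "((\<lambda>x. flat p x) \<longlongrightarrow> 0) (at_right 0)"
    by (rule Lim_transform_eventually) (auto simp: flat_def eventually_at_filter)
  moreover have "((\<lambda>x. flat p x) \<longlongrightarrow> 0) (at_left 0)"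
    by (rule Lim_transform_eventually[of "\<lambda>x. 0"]) (auto simp: flat_def eventually_at_filter)
  ultimately show ?thesis
    by (simp add: filterlim_split_at)
qed

lemma flat_has_derivative:
  "(flat p has_real_derivative flat ([:0, 0, 1:] * (p - pderiv p)) x) (at x)"
proof (cases "x = 0")
  case True
  have "((\<lambda>h. (flat p (0 + h) - flat p 0) / h) \<longlongrightarrow> 0) (at 0)"
    by (rule Lim_transform_eventually[OF flat_tendsto_0[of "[:0, 1:] * p"]])
      (auto simp: flat_def eventually_at_filter divide_simps)
  then show ?thesis
    using True by (simp add: DERIV_def flat_def)
next
  case False
  show ?thesis
  proof (cases "x < 0")
    case True
    have "((\<lambda>_. 0) has_real_derivative 0) (at x)" by simp
    then have "(flat p has_real_derivative 0) (at x)"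
      by (rule has_field_derivative_transform_within_open[of _ _ _ "{..<0}"])
        (use True in \<open>auto simp: flat_def\<close>)
    then show ?thesis using True by (simp add: flat_def)
  next
    case x: False
    have "((\<lambda>x. poly p (1 / x) * exp (- (1 / x))) has_real_derivative
       flat ([:0, 0, 1:] * (p - pderiv p)) x) (at x)"
      using False x
      by (auto intro!: derivative_eq_intros DERIV_chain2[OF poly_DERIV]
          simp: flat_def field_simps power2_eq_square)
    then show ?thesis
      by (rule has_field_derivative_transform_within_open[of _ _ _ "{0<..}"])
        (use x False in \<open>auto simp: flat_def\<close>)
  qed
qed

lemma C_infinity_flat: "C_infinity (flat p)"
proof -
  have "C_k k (flat p)" for k p
  proof (induction k arbitrary: p)
    case 0
    show ?case
      using flat_has_derivative by (auto intro!: DERIV_continuous_on)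
  next
    case (Suc k)
    let ?q = "[:0, 0, 1:] * (p - pderiv p)"
    have "(flat p has_derivative (\<lambda>v. flat ?q x * v)) (at x)" for x
      using flat_has_derivative[of p x] by (simp only: has_field_derivative_def)
    then show ?case
      by (rule C_k_SucI) (use Suc in simp)
  qed
  then show ?thesis by (simp add: C_infinity_def)
qed

text \<open>The step is the normalised primitive of a bump function.\<close>

lemma smooth_step_exists:
  obtains H k :: "real \<Rightarrow> real"
  where "C_infinity H" "\<And>x. (H has_real_derivative k x) (at x)" "continuous_on UNIV k"
    "\<And>x. 0 \<le> k x" "\<And>x. x \<le> 0 \<or> 1 \<le> x \<Longrightarrow> k x = 0"
    "\<And>x. x \<le> 0 \<Longrightarrow> H x = 0" "\<And>x. 1 \<le> x \<Longrightarrow> H x = 1" "\<And>x. 0 < x \<Longrightarrow> 0 < H x" "mono H"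
proof -
  define b where "b x = flat 1 x * flat 1 (1 + (- x))" for x
  have b_smooth: "C_infinity b"
    unfolding b_def[abs_def]
    by (intro C_infinity_mult C_infinity_flat C_infinity_compose[of "flat 1"] C_infinity_add
        C_infinity_const C_infinity_minus C_infinity_bounded_linear bounded_linear_ident)
  have b_nonneg: "0 \<le> b x" for x
    by (simp add: b_def flat_def)
  have b_zero: "b x = 0" if "x \<le> 0 \<or> 1 \<le> x" for x
    using that by (auto simp: b_def flat_def)
  have b_pos: "0 < b x" if "0 < x" "x < 1" for x
    using that by (simp add: b_def flat_def)
  define B where "B x = (LBINT y=0..x. b y)" for x :: real
  have B: "(B has_real_derivative b x) (at x)" for x
  proof -
    define l u where "l = min x 0 - 1" and "u = max x 0 + 1"
    have "((\<lambda>u. LBINT y=0..u. b y) has_vector_derivative b x) (at x within {l..u})"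
      unfolding zero_ereal_def
      by (rule interval_integral_FTC2)
        (use C_infinity_derivative(3)[OF b_smooth] in \<open>auto simp: l_def u_def intro: continuous_on_subset\<close>)
    then have "((\<lambda>u. LBINT y=0..u. b y) has_vector_derivative b x) (at x)"
      by (subst (asm) at_within_Icc_at) (auto simp: l_def u_def)
    then show ?thesis
      by (simp add: B_def[abs_def] has_real_derivative_iff_has_vector_derivative)
  qed
  have B_cont: "continuous_on S B" for S
    by (rule DERIV_continuous_on[OF has_field_derivative_at_within[OF B]])
  have B_flat: "(B has_real_derivative 0) (at x)" if "x \<le> 0 \<or> 1 \<le> x" for x
    using B[of x] b_zero[OF that] by simp
  have B0: "B 0 = 0" by (simp add: B_def zero_ereal_def)
  have B_mono: "B x \<le> B y" if "x \<le> y" for x y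
    using B b_nonneg that by (blast intro: DERIV_nonneg_imp_nondecreasing)
  have B_strict: "B x < B y" if "0 \<le> x" "x < y" "y \<le> 1" for x y
  proof (rule DERIV_pos_imp_increasing_open[OF that(2) _ B_cont])
    fix z assume "x < z" "z < y"
    then show "\<exists>d. (B has_real_derivative d) (at z) \<and> 0 < d"
      using B[of z] b_pos[of z] that by auto
  qed
  have B_neg: "B x = 0" if "x \<le> 0" for x
  proof (cases "x = 0")
    case False
    with that have "x < 0" by simp
    have "B x = B 0"
      by (rule DERIV_isconst2[of x 0 B, symmetric, OF \<open>x < 0\<close> B_cont])
        (use that \<open>x < 0\<close> in \<open>simp_all add: B_flat\<close>)
    then show ?thesis using B0 by simp
  qed (use B0 in simp)
  have B_large: "B x = B 1" if "1 \<le> x" for x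
  proof (cases "x = 1")
    case False
    with that have "1 < x" by simp
    show ?thesis
      by (rule DERIV_isconst2[of 1 x B, OF \<open>1 < x\<close> B_cont])
        (use that \<open>1 < x\<close> in \<open>simp_all add: B_flat\<close>)
  qed simp
  have c: "0 < B 1" using B_strict[of 0 1] B0 by simp
  define H where "H x = (1 / B 1) * B x" for x
  define k where "k x = (1 / B 1) * b x" for x
  have H: "(H has_real_derivative k x) (at x)" for x
    unfolding H_def[abs_def] k_def by (intro DERIV_cmult B)
  have k_smooth: "C_infinity k"
    unfolding k_def[abs_def] by (intro C_infinity_mult C_infinity_const b_smooth)
  have "C_infinity H"
  proof -
    have "(H has_derivative (\<lambda>v. k x * v)) (at x)" for x
      using H[of x] by (simp only: has_field_derivative_def)
    then have "C_k (Suc j) H" for j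
    proof (rule C_k_SucI)
      fix b :: real assume "b \<in> Basis"
      have "C_k j k" using k_smooth by (simp only: C_infinity_def)
      with \<open>b \<in> Basis\<close> show "C_k j (\<lambda>x. k x * b)" by simp
    qed
    from C_k_SucD[OF this] show ?thesis
      by (simp add: C_infinity_def)
  qed
  moreover have "0 < H x" if "0 < x" for x
  proof -
    have "0 < B (min x 1)" using B_strict[of 0 "min x 1"] B0 that by simp
    also have "\<dots> \<le> B x" by (rule B_mono) simp
    finally show ?thesis using c by (simp add: H_def)
  qed
  moreover have "mono H"
    using B_mono c by (auto simp: mono_def H_def divide_simps)
  ultimately show ?thesis
  proof (intro that[of H k])
    show "continuous_on UNIV k" by (rule C_infinity_derivative(3)[OF k_smooth])
    show "0 \<le> k x" for x using b_nonneg c by (simp add: k_def)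
    show "k x = 0" if "x \<le> 0 \<or> 1 \<le> x" for x using b_zero[OF that] by (simp add: k_def)
    show "H x = 0" if "x \<le> 0" for x using B_neg[OF that] by (simp add: H_def)
    show "H x = 1" if "1 \<le> x" for x using B_large[OF that] c by (simp add: H_def)
  qed (use H in auto)
qed

section \<open>Curves of measures and the Wasserstein distance\<close>

lemma P2D:
  assumes "\<mu> \<in> P2"
  shows "prob_space \<mu>" "sets \<mu> = sets borel" "integrable \<mu> (\<lambda>x. (norm x)\<^sup>2)" "space \<mu> = UNIV"
    "integrable \<mu> (\<lambda>x. norm x)"
proof -
  show p: "prob_space \<mu>" and s: "sets \<mu> = sets borel" and i: "integrable \<mu> (\<lambda>x. (norm x)\<^sup>2)"
    using assms by (auto simp: P2_def borel_prob_def)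
  show "space \<mu> = UNIV" using sets_eq_imp_space_eq[OF s] by simp
  interpret prob_space \<mu> by (rule p)
  show "integrable \<mu> (\<lambda>x. norm x)"
  proof (rule Bochner_Integration.integrable_bound)
    show "integrable \<mu> (\<lambda>x. 1 + (norm x)\<^sup>2)" using i by simp
    show "(\<lambda>x. norm x) \<in> borel_measurable \<mu>" using s by (simp cong: measurable_cong_sets)
    have "norm x \<le> 1 + (norm x)\<^sup>2" for x :: 'a
      using zero_le_power2[of "norm x - 1 / 2"] by (simp add: power2_eq_square algebra_simps)
    then show "AE x in \<mu>. norm (norm x) \<le> norm (1 + (norm x)\<^sup>2)"
      by (intro always_eventually) (auto intro: order_trans)
  qed
qed
lemma P2_integrable_id: "\<mu> \<in> P2 \<Longrightarrow> integrable \<mu> (\<lambda>x. x)"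
  using P2D(5)[of \<mu>] P2D(2)[of \<mu>]
  by (auto simp: integrable_iff_bounded cong: measurable_cong_sets)

lemma pair_coupling:
  assumes "\<mu> \<in> P2" "\<nu> \<in> P2"
  shows "\<mu> \<Otimes>\<^sub>M \<nu> \<in> couplings \<mu> \<nu>"
    and "(\<integral>\<^sup>+ (x, y). ennreal ((dist x y)\<^sup>2) \<partial>(\<mu> \<Otimes>\<^sub>M \<nu>)) < \<infinity>"
proof -
  interpret M: prob_space \<mu> by (rule P2D(1)[OF assms(1)])
  interpret N: prob_space \<nu> by (rule P2D(1)[OF assms(2)])
  interpret MN: pair_prob_space \<mu> \<nu> ..
  have sM: "sets \<mu> = sets borel" and sN: "sets \<nu> = sets borel"
    using P2D(2) assms by auto
  have s: "sets (\<mu> \<Otimes>\<^sub>M \<nu>) = sets borel"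
    using sets_pair_measure_cong[OF sM sN] by (simp only: borel_prod)
  have "distr (\<mu> \<Otimes>\<^sub>M \<nu>) borel fst = distr (\<mu> \<Otimes>\<^sub>M \<nu>) \<mu> fst"
    by (rule distr_cong) (simp_all add: sM)
  also have "\<dots> = \<mu>" by (rule N.distr_pair_fst)
  finally have 1: "distr (\<mu> \<Otimes>\<^sub>M \<nu>) borel fst = \<mu>" .
  have "distr (\<mu> \<Otimes>\<^sub>M \<nu>) borel snd = distr (\<mu> \<Otimes>\<^sub>M \<nu>) \<nu> snd"
    by (rule distr_cong) (simp_all add: sN)
  also have "\<dots> = distr (\<nu> \<Otimes>\<^sub>M \<mu>) \<nu> fst"
    by (subst MN.distr_pair_swap) (simp add: distr_distr comp_def case_prod_beta)
  also have "\<dots> = \<nu>"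
    by (rule M.distr_pair_fst)
  finally have 2: "distr (\<mu> \<Otimes>\<^sub>M \<nu>) borel snd = \<nu>" .
  show "\<mu> \<Otimes>\<^sub>M \<nu> \<in> couplings \<mu> \<nu>"
    using 1 2 s MN.prob_space_axioms by (simp add: couplings_def borel_prob_def)
  have i: "integrable (\<mu> \<Otimes>\<^sub>M \<nu>) (\<lambda>z. 2 * (norm (fst z))\<^sup>2 + 2 * (norm (snd z))\<^sup>2)"
  proof -
    have m: "fst \<in> measurable (\<mu> \<Otimes>\<^sub>M \<nu>) borel" "snd \<in> measurable (\<mu> \<Otimes>\<^sub>M \<nu>) borel"
      using measurable_fst[of \<mu> \<nu>] measurable_snd[of \<mu> \<nu>] sM sN by (simp_all cong: measurable_cong_sets)
    have "integrable (\<mu> \<Otimes>\<^sub>M \<nu>) (\<lambda>z. (norm (fst z))\<^sup>2)" "integrable (\<mu> \<Otimes>\<^sub>M \<nu>) (\<lambda>z. (norm (snd z))\<^sup>2)"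
      using integrable_distr_eq[OF m(1), of "\<lambda>x. (norm x)\<^sup>2"] integrable_distr_eq[OF m(2), of "\<lambda>x. (norm x)\<^sup>2"]
        P2D(3)[OF assms(1)] P2D(3)[OF assms(2)] by (simp_all add: 1 2)
    then show ?thesis by simp
  qed
  have "(\<integral>\<^sup>+ (x, y). ennreal ((dist x y)\<^sup>2) \<partial>(\<mu> \<Otimes>\<^sub>M \<nu>)) \<le>
     (\<integral>\<^sup>+ z. ennreal (2 * (norm (fst z))\<^sup>2 + 2 * (norm (snd z))\<^sup>2) \<partial>(\<mu> \<Otimes>\<^sub>M \<nu>))"
  proof (rule nn_integral_mono)
    fix z :: "'a \<times> 'a"
    show "(case z of (x, y) \<Rightarrow> ennreal ((dist x y)\<^sup>2)) \<le> ennreal (2 * (norm (fst z))\<^sup>2 + 2 * (norm (snd z))\<^sup>2)"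
    proof (cases z)
      case (Pair x y)
      have "dist x y ^ 2 \<le> (norm x + norm y)^2" 
        by (intro power_mono) (auto simp: dist_norm norm_triangle_ineq4)
      also have "\<dots> \<le> 2 * (norm x)\<^sup>2 + 2 * (norm y)\<^sup>2"
        using zero_le_power2[of "norm x - norm y"] by (simp add: power2_eq_square algebra_simps)
      finally show ?thesis using Pair by (simp add: ennreal_leI del: ennreal_plus)
    qed
  qed
  also have "\<dots> < \<infinity>"
    using i by (subst nn_integral_eq_integral) auto
  finally show "(\<integral>\<^sup>+ (x, y). ennreal ((dist x y)\<^sup>2) \<partial>(\<mu> \<Otimes>\<^sub>M \<nu>)) < \<infinity>" .
qed

text \<open>The product coupling has finite cost, so the infimum in \<open>W2\<close> is finite and is not collapsed to \<open>0\<close>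
  by \<open>enn2real\<close>.\<close>

lemma coupling_exists:
  assumes "\<mu> \<in> P2" "\<nu> \<in> P2" "W2 \<mu> \<nu> < d"
  obtains \<gamma> where "\<gamma> \<in> couplings \<mu> \<nu>" "(\<integral>\<^sup>+ (x, y). ennreal ((dist x y)\<^sup>2) \<partial>\<gamma>) < ennreal (d\<^sup>2)"
proof -
  let ?I = "INF \<gamma>\<in>couplings \<mu> \<nu>. \<integral>\<^sup>+ (x, y). ennreal ((dist x y)\<^sup>2) \<partial>\<gamma>"
  have fin: "?I < \<infinity>"
    using pair_coupling[OF assms(1,2)] INF_less_iff by blast
  have d: "0 < d" using assms(3) by (auto simp: W2_def intro: le_less_trans[rotated])
  have "enn2real ?I < d\<^sup>2"
    using assms(3) d unfolding W2_def by (metis real_sqrt_less_iff real_sqrt_unique less_imp_le)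
  then have "?I < ennreal (d\<^sup>2)"
    using fin by (subst (asm) enn2real_less_iff) auto
  then show ?thesis using that by (auto simp: INF_less_iff)
qed

text \<open>The hypothesis asks for less than Lipschitz continuity: it covers \<open>f = g = norm\<close> with \<open>e = 1\<close>, and
  every bounded uniformly continuous function with \<open>e\<close> arbitrarily small and \<open>K\<close> large.\<close>

lemma integral_diff_le_W2:
  fixes f g :: "'a::euclidean_space \<Rightarrow> real"
  assumes P: "\<mu> \<in> P2" "\<nu> \<in> P2" and W: "W2 \<mu> \<nu> < d"
    and f: "integrable \<mu> f" and g: "integrable \<nu> g"
    and le: "\<And>x y. \<bar>f x - g y\<bar> \<le> e + K * (dist x y)\<^sup>2" and K: "0 \<le> K"
  shows "\<bar>(\<integral>x. f x \<partial>\<mu>) - (\<integral>x. g x \<partial>\<nu>)\<bar> \<le> e + K * d\<^sup>2"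
proof -
  obtain \<gamma> where \<gamma>: "\<gamma> \<in> couplings \<mu> \<nu>"
    and cost: "(\<integral>\<^sup>+ (x, y). ennreal ((dist x y)\<^sup>2) \<partial>\<gamma>) < ennreal (d\<^sup>2)"
    using coupling_exists[OF P W] .
  from \<gamma> have sg: "sets \<gamma> = sets borel" and "prob_space \<gamma>"
    and m1: "distr \<gamma> borel fst = \<mu>" and m2: "distr \<gamma> borel snd = \<nu>"
    by (auto simp: couplings_def borel_prob_def)
  interpret prob_space \<gamma> by fact
  have [measurable]: "fst \<in> measurable \<gamma> borel" "snd \<in> measurable \<gamma> borel"
    using sg by (simp_all cong: measurable_cong_sets flip: borel_prod)
  have fb: "f \<in> borel_measurable borel" "g \<in> borel_measurable borel"
    using f g P2D(2)[OF P(1)] P2D(2)[OF P(2)] by (auto cong: measurable_cong_sets)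
  have F: "integrable \<gamma> (\<lambda>z. f (fst z))" "(\<integral>x. f x \<partial>\<mu>) = (\<integral>z. f (fst z) \<partial>\<gamma>)"
    using f fb unfolding m1[symmetric] by (simp_all add: integrable_distr_eq integral_distr)
  have G: "integrable \<gamma> (\<lambda>z. g (snd z))" "(\<integral>x. g x \<partial>\<nu>) = (\<integral>z. g (snd z) \<partial>\<gamma>)"
    using g fb unfolding m2[symmetric] by (simp_all add: integrable_distr_eq integral_distr)
  have D: "integrable \<gamma> (\<lambda>z. (dist (fst z) (snd z))\<^sup>2)"
    using less_trans[OF cost ennreal_less_top] by (intro integrableI_nonneg) (auto simp: case_prod_unfold)
  have cost': "(\<integral>z. (dist (fst z) (snd z))\<^sup>2 \<partial>\<gamma>) \<le> d\<^sup>2"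
    using cost nn_integral_eq_integral[OF D] by (simp add: case_prod_unfold ennreal_less_iff)
  have "\<bar>(\<integral>x. f x \<partial>\<mu>) - (\<integral>x. g x \<partial>\<nu>)\<bar> = \<bar>\<integral>z. f (fst z) - g (snd z) \<partial>\<gamma>\<bar>"
    using F G by simp
  also have "\<dots> \<le> (\<integral>z. \<bar>f (fst z) - g (snd z)\<bar> \<partial>\<gamma>)"
    by (rule integral_abs_bound)
  also have "\<dots> \<le> (\<integral>z. e + K * (dist (fst z) (snd z))\<^sup>2 \<partial>\<gamma>)"
    using F G D le by (intro integral_mono) auto
  also have "\<dots> = e + K * (\<integral>z. (dist (fst z) (snd z))\<^sup>2 \<partial>\<gamma>)"
    using D by (simp add: prob_space)
  also have "\<dots> \<le> e + K * d\<^sup>2"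
    using cost' K by (intro add_left_mono mult_left_mono)
  finally show ?thesis .
qed

lemma locally_AC_curve_modulus:
  assumes "locally_AC_curve \<rho>" "0 \<le> T"
  obtains F where "continuous_on {0..T} F"
    "\<And>s t. 0 \<le> s \<Longrightarrow> s \<le> t \<Longrightarrow> t \<le> T \<Longrightarrow> W2 (\<rho> s) (\<rho> t) \<le> F t - F s"
proof -
  obtain m :: "real \<Rightarrow> real" where m: "\<And>T. 0 \<le> T \<Longrightarrow> set_integrable lborel {0..T} m"
    and W: "\<And>s t. 0 \<le> s \<Longrightarrow> s \<le> t \<Longrightarrow> W2 (\<rho> s) (\<rho> t) \<le> (LINT r:{s..t}|lborel. m r)"
    using assms(1) unfolding locally_AC_curve_def by blast
  have i: "m integrable_on {0..T}"
    using set_borel_integral_eq_integral(1)[OF m[OF assms(2)]] .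
  show ?thesis
  proof
    show "continuous_on {0..T} (\<lambda>t. integral {0..t} m)"
      by (rule indefinite_integral_continuous_1[OF i])
    fix s t :: real assume st: "0 \<le> s" "s \<le> t" "t \<le> T"
    have "set_integrable lborel {s..t} m"
      by (rule set_integrable_subset[OF m[OF assms(2)]]) (use st in auto)
    then have "(LINT r:{s..t}|lborel. m r) = integral {s..t} m"
      by (rule set_borel_integral_eq_integral(2))
    moreover have "integral {0..s} m + integral {s..t} m = integral {0..t} m"
      by (rule Henstock_Kurzweil_Integration.integral_combine) (use st i in \<open>auto intro: integrable_on_subinterval\<close>)
    ultimately show "W2 (\<rho> s) (\<rho> t) \<le> integral {0..t} m - integral {0..s} m"
      using W[OF st(1,2)] by simp
  qed
qed

lemma locally_AC_curve_P2: "locally_AC_curve \<rho> \<Longrightarrow> 0 \<le> t \<Longrightarrow> \<rho> t \<in> P2"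
  by (simp add: locally_AC_curve_def)

lemma first_moment_locally_bounded:
  assumes AC: "locally_AC_curve \<rho>" and T: "0 \<le> T"
  obtains m where "\<And>t. 0 \<le> t \<Longrightarrow> t \<le> T \<Longrightarrow> (\<integral>x. norm x \<partial>\<rho> t) \<le> m"
proof -
  obtain F where cont: "continuous_on {0..T} F"
    and F: "\<And>s t. 0 \<le> s \<Longrightarrow> s \<le> t \<Longrightarrow> t \<le> T \<Longrightarrow> W2 (\<rho> s) (\<rho> t) \<le> F t - F s"
    using locally_AC_curve_modulus[OF assms] by blast
  obtain B where B: "\<And>t. t \<in> {0..T} \<Longrightarrow> F t \<le> B"
    using compact_imp_bounded[OF compact_continuous_image[OF cont compact_Icc]]
    by (metis bounded_real imageI abs_le_D1)
  define d where "d = B - F 0 + 1"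
  show ?thesis
  proof (rule that[of "(\<integral>x. norm x \<partial>\<rho> 0) + (1 + 1 * d\<^sup>2)"])
    fix t assume t: "0 \<le> t" "t \<le> T"
    have "W2 (\<rho> 0) (\<rho> t) < d"
      using F[of 0 t] B[of t] t by (simp add: d_def)
    moreover have "\<bar>norm x - norm y\<bar> \<le> 1 + 1 * (dist x y)\<^sup>2" for x y :: 'a
    proof -
      have "\<bar>norm x - norm y\<bar> \<le> dist x y" by (simp add: dist_norm norm_triangle_ineq3)
      moreover have "dist x y \<le> 1 + 1 * (dist x y)\<^sup>2"
        using zero_le_power2[of "dist x y - 1 / 2"] by (simp add: power2_eq_square algebra_simps)
      ultimately show ?thesis by linarith
    qed
    ultimately have "\<bar>(\<integral>x. norm x \<partial>\<rho> 0) - (\<integral>x. norm x \<partial>\<rho> t)\<bar> \<le> 1 + 1 * d\<^sup>2"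
      using AC t by (intro integral_diff_le_W2 P2D(5)) (auto intro: locally_AC_curve_P2)
    then show "(\<integral>x. norm x \<partial>\<rho> t) \<le> (\<integral>x. norm x \<partial>\<rho> 0) + (1 + 1 * d\<^sup>2)" by linarith
  qed
qed

lemma integrable_bounded_continuous:
  fixes f :: "'a::euclidean_space \<Rightarrow> real"
  assumes "\<mu> \<in> P2" "continuous_on UNIV f" "\<And>x. \<bar>f x\<bar> \<le> B"
  shows "integrable \<mu> f"
proof -
  interpret prob_space \<mu> by (rule P2D(1)[OF assms(1)])
  have "f \<in> borel_measurable \<mu>"
    using borel_measurable_continuous_onI[OF assms(2)] P2D(2)[OF assms(1)]
    by (simp cong: measurable_cong_sets)
  then show ?thesis
    using assms(3) by (intro integrable_const_bound[of _ B]) auto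
qed

lemma bounded_on_slab:
  fixes \<Phi> :: "real \<times> 'a::euclidean_space \<Rightarrow> real"
  assumes cont: "continuous_on UNIV \<Phi>" and z: "\<And>t x. 0 \<le> t \<Longrightarrow> t \<le> T \<Longrightarrow> S < norm x \<Longrightarrow> \<Phi> (t, x) = 0"
  obtains B where "0 < B" "\<And>t x. 0 \<le> t \<Longrightarrow> t \<le> T \<Longrightarrow> \<bar>\<Phi> (t, x)\<bar> \<le> B"
proof -
  have "compact (\<Phi> ` ({0..T} \<times> cball 0 S))"
    by (intro compact_continuous_image compact_Times compact_Icc compact_cball
        continuous_on_subset[OF cont] subset_UNIV)
  then obtain B where B: "0 < B" "\<And>z. z \<in> \<Phi> ` ({0..T} \<times> cball 0 S) \<Longrightarrow> norm z \<le> B"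
    using compact_imp_bounded bounded_pos by metis
  show ?thesis
  proof (rule that[OF B(1)])
    fix t x assume t: "0 \<le> t" "t \<le> T"
    show "\<bar>\<Phi> (t, x)\<bar> \<le> B"
    proof (cases "S < norm x")
      case True
      then show ?thesis using z[OF t, of x] B(1) by simp
    next
      case False
      then show ?thesis using B(2)[of "\<Phi> (t, x)"] t by auto
    qed
  qed
qed

text \<open>The uniform modulus of continuity of \<open>\<Phi>\<close> handles pairs of points at distance below \<open>d1\<close>; for the other
  pairs the crude bound \<open>2 * B\<close> is at most \<open>2 * B / d1\<^sup>2\<close> times the transport cost.\<close>

lemma continuous_integral_along_curve:
  fixes \<Phi> :: "real \<times> 'a::euclidean_space \<Rightarrow> real"
  assumes AC: "locally_AC_curve \<rho>" and T: "0 \<le> T" and cont: "continuous_on UNIV \<Phi>"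
    and z: "\<And>t x. 0 \<le> t \<Longrightarrow> t \<le> T \<Longrightarrow> S < norm x \<Longrightarrow> \<Phi> (t, x) = 0"
  shows "continuous_on {0..T} (\<lambda>t. \<integral>x. \<Phi> (t, x) \<partial>\<rho> t)"
proof -
  obtain F where Fcont: "continuous_on {0..T} F"
    and F: "\<And>s t. 0 \<le> s \<Longrightarrow> s \<le> t \<Longrightarrow> t \<le> T \<Longrightarrow> W2 (\<rho> s) (\<rho> t) \<le> F t - F s"
    using locally_AC_curve_modulus[OF AC T] by blast
  obtain B where B: "0 < B" "\<And>t x. 0 \<le> t \<Longrightarrow> t \<le> T \<Longrightarrow> \<bar>\<Phi> (t, x)\<bar> \<le> B"
    using bounded_on_slab[OF cont z] by blast
  let ?C = "{0..T} \<times> cball (0::'a) (S + 1)"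
  have uc: "uniformly_continuous_on ?C \<Phi>"
    by (intro compact_uniformly_continuous continuous_on_subset[OF cont] compact_Times) auto
  let ?u = "\<lambda>t. \<integral>x. \<Phi> (t, x) \<partial>\<rho> t"
  have int: "integrable (\<rho> t) (\<lambda>x. \<Phi> (t, x))" if "0 \<le> t" "t \<le> T" for t
    using that B(2) by (intro integrable_bounded_continuous locally_AC_curve_P2[OF AC]
       continuous_on_compose2[OF cont]) (auto intro: continuous_intros)
  have main: "\<exists>\<delta>>0. \<forall>s t. 0 \<le> s \<and> s \<le> t \<and> t \<le> T \<and> t - s < \<delta> \<longrightarrow> \<bar>?u s - ?u t\<bar> < e"
    if e: "0 < e" for e
  proof -
    obtain d where d: "0 < d" and ud: "\<And>p q. p \<in> ?C \<Longrightarrow> q \<in> ?C \<Longrightarrow> dist p q < d \<Longrightarrow> \<bar>\<Phi> p - \<Phi> q\<bar> < e / 3"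
      using uc e unfolding uniformly_continuous_on_def dist_real_def
      by (metis abs_minus_commute divide_pos_pos zero_less_numeral)
    define d1 where "d1 = min d 1 / 2"
    have d1: "0 < d1" "d1 < 1" "2 * d1 \<le> d" using d by (auto simp: d1_def)
    define K where "K = 2 * B / d1\<^sup>2"
    have K: "0 \<le> K" using B(1) by (simp add: K_def)
    have est: "\<bar>\<Phi> (s, x) - \<Phi> (t, y)\<bar> \<le> e / 3 + K * (dist x y)\<^sup>2"
      if st: "0 \<le> s" "s \<le> t" "t \<le> T" "t - s < d1" for s t x y
    proof (cases "dist x y < d1")
      case True
      have "\<bar>\<Phi> (s, x) - \<Phi> (t, y)\<bar> \<le> e / 3"
      proof (cases "(s, x) \<in> ?C \<and> (t, y) \<in> ?C")
        case in_C: True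
        have "dist (s, x) (t, y) \<le> \<bar>s - t\<bar> + dist x y"
          unfolding dist_Pair_Pair dist_real_def by (rule order_trans[OF sqrt_sum_squares_le_sum]) auto
        also have "\<dots> < d" using True st d1 by linarith
        finally show ?thesis using ud in_C by (meson less_imp_le)
      next
        case False
        have "\<bar>norm x - norm y\<bar> \<le> dist x y" by (simp add: dist_norm norm_triangle_ineq3)
        then have "S < norm x" "S < norm y" using False True d1 st by auto
        then show ?thesis using z[of s x] z[of t y] st e by simp
      qed
      then show ?thesis using mult_nonneg_nonneg[OF K zero_le_power2, of "dist x y"] by linarith
    next
      case False
      then have "d1\<^sup>2 \<le> (dist x y)\<^sup>2" using d1 by (intro power_mono) auto
      then have "2 * B \<le> K * (dist x y)\<^sup>2"
        using d1 B(1) by (simp add: K_def field_simps)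
      moreover have "\<bar>\<Phi> (s, x) - \<Phi> (t, y)\<bar> \<le> 2 * B"
        using B(2)[of s x] B(2)[of t y] st by linarith
      ultimately show ?thesis using e by simp
    qed
    define \<eta> where "\<eta> = sqrt (e / 3 / (K + 1))"
    have \<eta>: "0 < \<eta>" "K * \<eta>\<^sup>2 \<le> e / 3" using e K by (auto simp: \<eta>_def field_simps)
    have "uniformly_continuous_on {0..T} F"
      by (rule compact_uniformly_continuous[OF Fcont compact_Icc])
    then obtain \<delta> where \<delta>: "0 < \<delta>" "\<And>s t. s \<in> {0..T} \<Longrightarrow> t \<in> {0..T} \<Longrightarrow> dist s t < \<delta> \<Longrightarrow> dist (F s) (F t) < \<eta>"
      using \<eta>(1) unfolding uniformly_continuous_on_def by metis
    show ?thesis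
    proof (intro exI[of _ "min \<delta> d1"] conjI allI impI)
      show "0 < min \<delta> d1" using \<delta> d1 by simp
      fix s t assume st: "0 \<le> s \<and> s \<le> t \<and> t \<le> T \<and> t - s < min \<delta> d1"
      then have "dist (F s) (F t) < \<eta>" by (intro \<delta>) (auto simp: dist_real_def)
      then have "W2 (\<rho> s) (\<rho> t) < \<eta>" using F[of s t] st by (auto simp: dist_real_def)
      then have "\<bar>?u s - ?u t\<bar> \<le> e / 3 + K * \<eta>\<^sup>2"
        using st K by (intro integral_diff_le_W2 est int locally_AC_curve_P2[OF AC]) auto
      then show "\<bar>?u s - ?u t\<bar> < e" using \<eta>(2) e by linarith
    qed
  qed
  show ?thesis
    unfolding continuous_on_iff
  proof (intro ballI allI impI)
    fix t e :: real assume t: "t \<in> {0..T}" and "0 < e"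
    then obtain \<delta> where \<delta>: "0 < \<delta>"
      "\<And>s t. 0 \<le> s \<Longrightarrow> s \<le> t \<Longrightarrow> t \<le> T \<Longrightarrow> t - s < \<delta> \<Longrightarrow> \<bar>?u s - ?u t\<bar> < e"
      using main[of e] by blast
    show "\<exists>d>0. \<forall>s\<in>{0..T}. dist s t < d \<longrightarrow> dist (?u s) (?u t) < e"
    proof (intro exI[of _ \<delta>] conjI ballI impI)
      fix s assume s: "s \<in> {0..T}" "dist s t < \<delta>"
      show "dist (?u s) (?u t) < e"
      proof (cases "s \<le> t")
        case True
        then show ?thesis using \<delta>(2)[of s t] s t by (simp add: dist_real_def)
      next
        case False
        then show ?thesis using \<delta>(2)[of t s] s t by (simp add: dist_real_def abs_minus_commute)
      qed
    qed (use \<delta> in simp)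
  qed
qed

section \<open>The continuity equation tested in space and time\<close>

lemma grad_eqI: "GDERIV f x :> D \<Longrightarrow> grad f x = D"
  unfolding grad_def
proof (rule the_equality)
  fix E assume "GDERIV f x :> D" "GDERIV f x :> E"
  then have "(\<lambda>h. h \<bullet> D) = (\<lambda>h. h \<bullet> E)"
    unfolding gderiv_def by (rule has_derivative_unique)
  then show "E = D"
    by (metis inner_commute vector_eq_ldot)
qed

text \<open>The integrand of the continuity equation is the derivative of the test function in the space-time
  direction \<open>(1, v)\<close>. All later computations use this form.\<close>

lemma deriv_grad_of_has_derivative:
  fixes \<phi> :: "real \<times> 'a::euclidean_space \<Rightarrow> real"
  assumes D: "(\<phi> has_derivative D) (at (t, x))"
  shows "deriv (\<lambda>s. \<phi> (s, x)) t + grad (\<lambda>y. \<phi> (t, y)) x \<bullet> v = D (1, v)"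
proof -
  have lin: "linear D" using D has_derivative_linear by blast
  have "((\<lambda>s. \<phi> (s, x)) has_derivative (\<lambda>h. D (h, 0))) (at t)"
    by (rule has_derivative_compose[where f = "\<lambda>s. (s, x)" and f' = "\<lambda>h. (h, 0)" and g = \<phi>])
      (use D in \<open>auto intro!: derivative_eq_intros\<close>)
  moreover have "(\<lambda>h. D (h, 0)) = (*) (D (1, 0))"
  proof
    fix h
    show "D (h, 0) = D (1, 0) * h" using linear_scale[OF lin, of h "(1, 0)"] by simp
  qed
  ultimately have t: "deriv (\<lambda>s. \<phi> (s, x)) t = D (1, 0)"
    by (intro DERIV_imp_deriv) (simp only: has_field_derivative_def)
  let ?g = "\<Sum>b\<in>Basis. D (0, b) *\<^sub>R b"
  have g: "D (0, h) = h \<bullet> ?g" for h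
  proof -
    have lin2: "linear (\<lambda>h. D (0, h))"
      using lin by (intro linear_compose[OF _ lin, unfolded comp_def] linearI) auto
    have "D (0, h) = D (0, \<Sum>b\<in>Basis. (h \<bullet> b) *\<^sub>R b)" by (simp add: euclidean_representation)
    also have "\<dots> = (\<Sum>b\<in>Basis. (h \<bullet> b) * D (0, b))"
      using linear_sum[OF lin2, of "\<lambda>b. (h \<bullet> b) *\<^sub>R b" Basis] linear_scale[OF lin2] by simp
    finally show ?thesis by (simp add: inner_sum_right mult.commute)
  qed
  have g': "(\<lambda>h. D (0, h)) = (\<lambda>h. h \<bullet> ?g)"
    by (rule ext) (rule g)
  have "((\<lambda>y. \<phi> (t, y)) has_derivative (\<lambda>h. D (0, h))) (at x)"
    by (rule has_derivative_compose[where f = "\<lambda>y. (t, y)" and f' = "\<lambda>h. (0, h)" and g = \<phi>])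
      (use D in \<open>auto intro!: derivative_eq_intros\<close>)
  then have "grad (\<lambda>y. \<phi> (t, y)) x = ?g"
    unfolding g' by (intro grad_eqI) (simp only: gderiv_def)
  then have "grad (\<lambda>y. \<phi> (t, y)) x \<bullet> v = D (0, v)"
    using g[of v] by (simp only: inner_commute)
  moreover have "D (1, 0) + D (0, v) = D (1, v)"
    using linear_add[OF lin, of "(1, 0)" "(0, v)"] by simp
  ultimately show ?thesis using t by simp
qed

lemma integrable_derivative_along:
  fixes \<Phi> :: "real \<times> 'a::euclidean_space \<Rightarrow> real"
  assumes \<mu>: "\<mu> \<in> P2" and \<Phi>: "C_infinity \<Phi>" and v: "integrable \<mu> v"
    and z: "\<And>t x. 0 \<le> t \<Longrightarrow> t \<le> T \<Longrightarrow> S < norm x \<Longrightarrow> \<Phi> (t, x) = 0"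
    and r: "0 < r" "r < T"
  shows "integrable \<mu> (\<lambda>x. frechet_derivative \<Phi> (at (r, x)) (1, v x))"
proof -
  let ?D = "\<lambda>x. frechet_derivative \<Phi> (at (r, x))"
  have D0: "?D x w = 0" if "S < norm x" for x w
  proof -
    have op: "open ({0<..<T} \<times> {x::'a. S < norm x})"
      by (intro open_Times) (auto intro: open_Collect_less continuous_intros)
    have "((\<lambda>_. 0) has_derivative ?D x) (at (r, x))"
      by (rule has_derivative_transform_within_open[OF C_infinity_derivative(1)[OF \<Phi>] op])
        (use r that z in auto)
    then have "?D x = (\<lambda>_. 0)"
      using has_derivative_const by (rule has_derivative_unique)
    then show ?thesis by simp
  qed
  have cont: "continuous_on UNIV (\<lambda>x. ?D x w)" for w
    by (rule continuous_on_compose2[OF C_infinity_derivative(2)[OF \<Phi>]]) (auto intro: continuous_intros)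
  have bnd: "\<exists>B. \<forall>x. \<bar>?D x w\<bar> \<le> B" for w
  proof -
    have "compact ((\<lambda>x. ?D x w) ` cball 0 S)"
      by (intro compact_continuous_image continuous_on_subset[OF cont]) auto
    then obtain B where B: "0 < B" "\<And>y. y \<in> (\<lambda>x. ?D x w) ` cball 0 S \<Longrightarrow> norm y \<le> B"
      using compact_imp_bounded bounded_pos by metis
    have "\<bar>?D x w\<bar> \<le> B" for x
      using D0[of x w] B(1) B(2)[of "?D x w"] by (cases "S < norm x") auto
    then show ?thesis by blast
  qed
  have int: "integrable \<mu> (\<lambda>x. ?D x w)" for w
    using bnd[of w] integrable_bounded_continuous[OF \<mu> cont] by blast
  have split: "?D x (1, v x) = ?D x (1, 0) + (\<Sum>b\<in>Basis. (v x \<bullet> b) * ?D x (0, b))" for x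
  proof -
    have lin: "linear (?D x)"
      using C_infinity_derivative(1)[OF \<Phi>] has_derivative_linear by blast
    have lin2: "linear (\<lambda>h. ?D x (0, h))"
      using lin by (intro linear_compose[OF _ lin, unfolded comp_def] linearI) auto
    have "?D x (0, v x) = ?D x (0, \<Sum>b\<in>Basis. (v x \<bullet> b) *\<^sub>R b)" by (simp add: euclidean_representation)
    also have "\<dots> = (\<Sum>b\<in>Basis. (v x \<bullet> b) * ?D x (0, b))"
      using linear_sum[OF lin2, of "\<lambda>b. (v x \<bullet> b) *\<^sub>R b" Basis] linear_scale[OF lin2] by simp
    finally show ?thesis
      using linear_add[OF lin, of "(1, 0)" "(0, v x)"] by simp
  qed
  have "integrable \<mu> (\<lambda>x. (v x \<bullet> b) * ?D x (0, b))" for b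
  proof -
    obtain B where B: "\<And>x. \<bar>?D x (0, b)\<bar> \<le> B" using bnd by blast
    have vb: "integrable \<mu> (\<lambda>x. v x \<bullet> b)" using v by simp
    show ?thesis
    proof (rule Bochner_Integration.integrable_bound)
      show "integrable \<mu> (\<lambda>x. B * (v x \<bullet> b))" using vb by simp
      show "(\<lambda>x. (v x \<bullet> b) * ?D x (0, b)) \<in> borel_measurable \<mu>"
        using vb int by (intro borel_measurable_times borel_measurable_integrable)
      have "0 \<le> B" using B[of 0] by linarith
      then show "AE x in \<mu>. norm ((v x \<bullet> b) * ?D x (0, b)) \<le> norm (B * (v x \<bullet> b))"
        using mult_right_mono[OF B abs_ge_zero]
        by (intro always_eventually) (simp add: abs_mult mult.commute)
    qed
  qed
  then show ?thesis
    unfolding split using int by (intro Bochner_Integration.integrable_add Bochner_Integration.integrable_sum)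
qed

lemma time_localization_test_function:
  fixes \<Phi> :: "real \<times> 'a::euclidean_space \<Rightarrow> real"
  assumes \<theta>: "C_infinity \<theta>" and \<Phi>: "C_infinity \<Phi>" and a: "0 < a"
    and \<theta>0: "\<And>r. \<not> (a \<le> r \<and> r \<le> T) \<Longrightarrow> \<theta> r = 0"
    and z: "\<And>t x. 0 \<le> t \<Longrightarrow> t \<le> T \<Longrightarrow> S < norm x \<Longrightarrow> \<Phi> (t, x) = 0"
  shows "(\<lambda>z. \<theta> (fst z) * \<Phi> z) \<in> test_functions"
proof -
  let ?A = "closure {z. \<theta> (fst z) * \<Phi> z \<noteq> 0}"
  have "{z. \<theta> (fst z) * \<Phi> z \<noteq> 0} \<subseteq> {a..T} \<times> cball 0 S"
  proof
    fix q assume "q \<in> {z. \<theta> (fst z) * \<Phi> z \<noteq> 0}"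
    then have "\<theta> (fst q) \<noteq> 0" "\<Phi> (fst q, snd q) \<noteq> 0" by auto
    with \<theta>0[of "fst q"] z[of "fst q" "snd q"] a
    have "a \<le> fst q \<and> fst q \<le> T" "norm (snd q) \<le> S" by force+
    then show "q \<in> {a..T} \<times> cball 0 S" by (auto simp: mem_Times_iff)
  qed
  then have sub: "?A \<subseteq> {a..T} \<times> cball 0 S"
    by (intro closure_minimal closed_Times) auto
  have "compact ?A"
    using sub by (intro compact_closure[THEN iffD2] bounded_subset[OF bounded_Times[OF bounded_closed_interval bounded_cball]])
      (rule order_trans[OF closure_subset sub])
  moreover have "?A \<subseteq> {0<..} \<times> UNIV" using sub a by auto
  ultimately show ?thesis
    unfolding test_functions_def using \<theta> \<Phi> by (auto intro: C_infinity_mult C_infinity_fst)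
qed

text \<open>Multiplying \<open>\<Phi>\<close> by a cutoff in time turns it into an admissible test function. What remains
  is a one-dimensional weak equation between \<open>u\<close> and its derivative \<open>J\<close>.\<close>

lemma continuity_equation_localized:
  fixes \<Phi> :: "real \<times> 'a::euclidean_space \<Rightarrow> real"
  assumes AC: "locally_AC_curve \<rho>" and CE: "continuity_equation \<rho> v"
    and \<theta>: "C_infinity \<theta>" "\<And>r. (\<theta> has_real_derivative \<theta>' r) (at r)"
    and \<Phi>: "C_infinity \<Phi>" and a: "0 < a" "b < T"
    and \<theta>0: "\<And>r. \<not> (a \<le> r \<and> r \<le> b) \<Longrightarrow> \<theta> r = 0"
    and z: "\<And>t x. 0 \<le> t \<Longrightarrow> t \<le> T \<Longrightarrow> S < norm x \<Longrightarrow> \<Phi> (t, x) = 0"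
    and v: "\<And>r. a \<le> r \<Longrightarrow> r \<le> b \<Longrightarrow> integrable (\<rho> r) (v r)"
  defines "u \<equiv> \<lambda>r. \<integral>x. \<Phi> (r, x) \<partial>\<rho> r"
    and "J \<equiv> \<lambda>r. \<integral>x. frechet_derivative \<Phi> (at (r, x)) (1, v r x) \<partial>\<rho> r"
  shows "set_integrable lborel {0<..} (\<lambda>r. \<theta>' r * u r + \<theta> r * J r)"
    and "(LINT r:{0<..}|lborel. \<theta>' r * u r + \<theta> r * J r) = 0"
proof -
  let ?\<phi> = "\<lambda>z. \<theta> (fst z) * \<Phi> z"
  have \<theta>'0: "\<theta>' r = 0" if "\<not> (a \<le> r \<and> r \<le> b)" for r
  proof -
    have "open {r. r < a \<or> b < r}"
      using open_Un[of "{..<a}" "{b<..}"] by (simp add: Un_def)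
    then have "((\<lambda>_. 0) has_real_derivative \<theta>' r) (at r)"
      by (rule has_field_derivative_transform_within_open[OF \<theta>(2)]) (use that \<theta>0 in auto)
    then show ?thesis using DERIV_const DERIV_unique by blast
  qed
  have test: "?\<phi> \<in> test_functions"
    by (rule time_localization_test_function[OF \<theta>(1) \<Phi> a(1) _ z]) (use \<theta>0 a in auto)
  have dphi: "(?\<phi> has_derivative
      (\<lambda>h. \<theta> r * frechet_derivative \<Phi> (at (r, x)) h + (\<theta>' r * fst h) * \<Phi> (r, x))) (at (r, x))" for r x
  proof -
    have "((\<lambda>z. \<theta> (fst z)) has_derivative (\<lambda>h. \<theta>' r * fst h)) (at (r, x))"
      by (rule has_derivative_compose[of fst fst "(r, x)" UNIV \<theta> "(*) (\<theta>' r)"])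
        (use \<theta>(2)[of r] in \<open>auto simp: has_field_derivative_def intro: bounded_linear_imp_has_derivative bounded_linear_fst\<close>)
    from has_derivative_mult[OF this C_infinity_derivative(1)[OF \<Phi>, of "(r, x)"]]
    show ?thesis by simp
  qed
  let ?I = "\<lambda>t. LINT x|\<rho> t. deriv (\<lambda>s. ?\<phi> (s, x)) t + grad (\<lambda>y. ?\<phi> (t, y)) x \<bullet> v t x"
  have I: "?I r = \<theta>' r * u r + \<theta> r * J r" if "0 < r" for r
  proof -
    have "?I r = (\<integral>x. \<theta> r * frechet_derivative \<Phi> (at (r, x)) (1, v r x) + \<theta>' r * \<Phi> (r, x) \<partial>\<rho> r)"
      by (intro Bochner_Integration.integral_cong refl trans[OF deriv_grad_of_has_derivative[OF dphi]]) simp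
    also have "\<dots> = \<theta>' r * u r + \<theta> r * J r"
    proof (cases "a \<le> r \<and> r \<le> b")
      case True
      then have \<mu>: "\<rho> r \<in> P2" using a AC by (auto intro: locally_AC_curve_P2)
      obtain B where "\<And>t x. 0 \<le> t \<Longrightarrow> t \<le> T \<Longrightarrow> \<bar>\<Phi> (t, x)\<bar> \<le> B"
        using bounded_on_slab[OF C_infinity_derivative(3)[OF \<Phi>] z] by blast
      then have "integrable (\<rho> r) (\<lambda>x. \<Phi> (r, x))"
        using True a by (intro integrable_bounded_continuous[OF \<mu>, of _ B]
          continuous_on_compose2[OF C_infinity_derivative(3)[OF \<Phi>]]) (auto intro: continuous_intros)
      moreover have "integrable (\<rho> r) (\<lambda>x. frechet_derivative \<Phi> (at (r, x)) (1, v r x))"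
        using True a v by (intro integrable_derivative_along[OF \<mu> \<Phi> _ z]) auto
      ultimately show ?thesis by (simp add: u_def J_def)
    next
      case False
      then show ?thesis using \<theta>0 \<theta>'0 by simp
    qed
    finally show ?thesis .
  qed
  have "set_integrable lborel {0<..} ?I \<and> (LINT r:{0<..}|lborel. ?I r) = 0"
    using bspec[OF CE[unfolded continuity_equation_def Let_def] test] .
  moreover have "set_integrable lborel {0<..} ?I \<longleftrightarrow> set_integrable lborel {0<..} (\<lambda>r. \<theta>' r * u r + \<theta> r * J r)"
    by (rule set_integrable_cong) (use I in auto)
  moreover have "(LINT r:{0<..}|lborel. ?I r) = (LINT r:{0<..}|lborel. \<theta>' r * u r + \<theta> r * J r)"
    by (rule set_lebesgue_integral_cong) (use I in auto)
  ultimately show "set_integrable lborel {0<..} (\<lambda>r. \<theta>' r * u r + \<theta> r * J r)"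
    and "(LINT r:{0<..}|lborel. \<theta>' r * u r + \<theta> r * J r) = 0"
    by (simp_all only:)
qed

lemma DERIV_rescale:
  fixes H k :: "real \<Rightarrow> real"
  assumes "\<And>x. (H has_real_derivative k x) (at x)" "e \<noteq> 0"
  shows "((\<lambda>x. H ((x - a) / e)) has_real_derivative k ((x - a) / e) / e) (at x)"
proof -
  have "((\<lambda>x. (x - a) / e) has_real_derivative 1 / e) (at x)"
    using assms(2) by (auto intro!: derivative_eq_intros)
  from DERIV_chain2[OF assms(1) this] show ?thesis by simp
qed

lemma has_bochner_integral_scaled_bump:
  fixes H k :: "real \<Rightarrow> real"
  assumes H: "\<And>x. (H has_real_derivative k x) (at x)" and k: "continuous_on UNIV k"
    "\<And>x. x \<le> 0 \<or> 1 \<le> x \<Longrightarrow> k x = 0"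
    and H01: "H 0 = 0" "H 1 = 1" and e: "0 < e" and a: "0 < a"
  shows "has_bochner_integral lborel (\<lambda>r. indicator {0<..} r *\<^sub>R (k ((r - a) / e) / e)) 1"
proof -
  have "has_bochner_integral lborel (\<lambda>r. (k ((r - a) / e) / e) * indicator {a..a + e} r)
     (H ((a + e - a) / e) - H ((a - a) / e))"
  proof (rule has_bochner_integral_FTC_Icc_real)
    show "a \<le> a + e" using e by simp
    fix x
    show "((\<lambda>x. H ((x - a) / e)) has_real_derivative k ((x - a) / e) / e) (at x)"
      using e by (intro DERIV_rescale H) auto
    have "continuous_on UNIV (\<lambda>x. k ((x - a) / e) / e)"
      by (intro continuous_intros continuous_on_compose2[OF k(1)]) (use e in auto)
    then show "isCont (\<lambda>x. k ((x - a) / e) / e) x"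
      by (simp add: continuous_on_eq_continuous_at)
  qed
  moreover have eq: "(k ((r - a) / e) / e) * indicator {a..a + e} r =
      indicator {0<..} r *\<^sub>R (k ((r - a) / e) / e)" for r
  proof (cases "a \<le> r \<and> r \<le> a + e")
    case False
    then have "k ((r - a) / e) = 0" using e by (intro k(2)) (auto simp: field_simps)
    then show ?thesis by simp
  qed (use a in auto)
  ultimately show ?thesis using e H01 unfolding eq by simp
qed

text \<open>If \<open>u\<close> decreased from \<open>s\<close> to \<open>t\<close>, choose for \<open>\<theta>\<close> a smooth plateau that rises just after \<open>s\<close> and falls
  just before \<open>t\<close>. Its derivative is the difference of two bumps of mass one, so the integral of
  \<open>\<theta>' * u\<close> is close to \<open>u s - u t > 0\<close>, whereas the integral of \<open>\<theta> * J\<close> is nonnegative; but they add up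
  to zero. Staying strictly inside the interval keeps the test function away from time \<open>0\<close>, so that
  \<open>s = 0\<close> is allowed.\<close>

lemma continuity_equation_monotone:
  fixes \<Phi> :: "real \<times> 'a::euclidean_space \<Rightarrow> real"
  assumes AC: "locally_AC_curve \<rho>" and CE: "continuity_equation \<rho> v" and \<Phi>: "C_infinity \<Phi>"
    and z: "\<And>t x. 0 \<le> t \<Longrightarrow> t \<le> T \<Longrightarrow> S < norm x \<Longrightarrow> \<Phi> (t, x) = 0"
    and st: "0 \<le> s" "s \<le> t" "t \<le> T"
    and v: "\<And>r. s < r \<Longrightarrow> r < t \<Longrightarrow> integrable (\<rho> r) (v r)"
    and J: "\<And>r. s < r \<Longrightarrow> r < t \<Longrightarrow>
        0 \<le> (\<integral>x. frechet_derivative \<Phi> (at (r, x)) (1, v r x) \<partial>\<rho> r)"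
  shows "(\<integral>x. \<Phi> (s, x) \<partial>\<rho> s) \<le> (\<integral>x. \<Phi> (t, x) \<partial>\<rho> t)"
proof (rule ccontr)
  let ?u = "\<lambda>r. \<integral>x. \<Phi> (r, x) \<partial>\<rho> r"
  let ?J = "\<lambda>r. \<integral>x. frechet_derivative \<Phi> (at (r, x)) (1, v r x) \<partial>\<rho> r"
  assume "\<not> ?thesis"
  then have less: "?u t < ?u s" by simp
  then have "s \<noteq> t" by auto
  with st have "s < t" by simp
  define \<epsilon> where "\<epsilon> = (?u s - ?u t) / 3"
  have \<epsilon>: "0 < \<epsilon>" using less by (simp add: \<epsilon>_def)
  have cont: "continuous_on {0..T} ?u"
    by (rule continuous_integral_along_curve[OF AC _ C_infinity_derivative(3)[OF \<Phi>] z]) (use st in auto)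
  obtain d1 where d1: "0 < d1" "\<And>r. r \<in> {0..T} \<Longrightarrow> dist r s < d1 \<Longrightarrow> dist (?u r) (?u s) < \<epsilon>"
    using cont[unfolded continuous_on_iff, rule_format, of s \<epsilon>] \<epsilon> st by auto
  obtain d2 where d2: "0 < d2" "\<And>r. r \<in> {0..T} \<Longrightarrow> dist r t < d2 \<Longrightarrow> dist (?u r) (?u t) < \<epsilon>"
    using cont[unfolded continuous_on_iff, rule_format, of t \<epsilon>] \<epsilon> st by auto
  define e where "e = min (min d1 d2) (t - s) / 4"
  have e: "0 < e" "4 * e \<le> d1" "4 * e \<le> d2" "4 * e \<le> t - s"
    using d1 d2 \<open>s < t\<close> by (auto simp: e_def)
  define a b where "a = s + e" and "b = t - 2 * e"
  have ab: "0 < a" "a \<le> b" "b + e < T" using e st by (auto simp: a_def b_def)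
  obtain H k :: "real \<Rightarrow> real" where Hs: "C_infinity H" and Hk: "\<And>x. (H has_real_derivative k x) (at x)"
    and kc: "continuous_on UNIV k" and k0: "\<And>x. 0 \<le> k x" and kz: "\<And>x. x \<le> 0 \<or> 1 \<le> x \<Longrightarrow> k x = 0"
    and H0: "\<And>x. x \<le> 0 \<Longrightarrow> H x = 0" and H1: "\<And>x. 1 \<le> x \<Longrightarrow> H x = 1" and Hpos: "\<And>x. 0 < x \<Longrightarrow> 0 < H x" and Hm: "mono H"
    by (rule smooth_step_exists) (rule that)
  define \<theta> where "\<theta> r = H ((1 / e) * r + (- a / e)) - H ((1 / e) * r + (- b / e))" for r
  have arg: "(1 / e) * r + (- c / e) = (r - c) / e" for r c by (simp add: diff_divide_distrib)
  define k1 k2 where "k1 r = k ((r - a) / e) / e" and "k2 r = k ((r - b) / e) / e" for r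
  have \<theta>_smooth: "C_infinity \<theta>"
    unfolding \<theta>_def[abs_def]
    by (intro C_infinity_diff C_infinity_compose[OF Hs] C_infinity_add C_infinity_const
        C_infinity_bounded_linear bounded_linear_mult_right)
  have d\<theta>: "(\<theta> has_real_derivative k1 r - k2 r) (at r)" for r
    unfolding \<theta>_def[abs_def] arg k1_def k2_def
    using e(1) by (intro DERIV_diff DERIV_rescale Hk) auto
  have \<theta>0: "\<theta> r = 0" if "\<not> (a \<le> r \<and> r \<le> b + e)" for r
  proof (cases "r < a")
    case True
    then have "(r - a) / e \<le> 0" "(r - b) / e \<le> 0" using ab e by (auto simp: field_simps)
    then show ?thesis by (simp only: \<theta>_def arg H0)
  next
    case False
    then have "1 \<le> (r - a) / e" "1 \<le> (r - b) / e" using that ab e by (auto simp: field_simps)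
    then show ?thesis by (simp only: \<theta>_def arg H1)
  qed
  have \<theta>_nonneg: "0 \<le> \<theta> r" for r
    unfolding \<theta>_def arg diff_ge_0_iff_ge
    by (intro monoD[OF Hm] divide_right_mono) (use ab e in auto)
  have v': "integrable (\<rho> r) (v r)" if "a \<le> r" "r \<le> b + e" for r
    using that v[of r] e by (auto simp: a_def b_def)
  have loc: "set_integrable lborel {0<..} (\<lambda>r. (k1 r - k2 r) * ?u r + \<theta> r * ?J r)"
     "(LINT r:{0<..}|lborel. (k1 r - k2 r) * ?u r + \<theta> r * ?J r) = 0"
    using continuity_equation_localized[OF AC CE \<theta>_smooth d\<theta> \<Phi> ab(1) ab(3) \<theta>0 z v'] by simp_all
  have bump1: "has_bochner_integral lborel (\<lambda>r. indicator {0<..} r *\<^sub>R k1 r) 1"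
    unfolding k1_def by (rule has_bochner_integral_scaled_bump[OF Hk kc kz]) (use H0 H1 e ab in auto)
  have bump2: "has_bochner_integral lborel (\<lambda>r. indicator {0<..} r *\<^sub>R k2 r) 1"
    unfolding k2_def by (rule has_bochner_integral_scaled_bump[OF Hk kc kz]) (use H0 H1 e ab in auto)
  let ?\<alpha> = "?u s - \<epsilon>" and ?\<beta> = "?u t + \<epsilon>"
  have bumps: "has_bochner_integral lborel
      (\<lambda>r. ?\<alpha> * (indicator {0<..} r *\<^sub>R k1 r) - ?\<beta> * (indicator {0<..} r *\<^sub>R k2 r)) (?\<alpha> * 1 - ?\<beta> * 1)"
    by (intro has_bochner_integral_diff has_bochner_integral_mult_right bump1 bump2)
  have pw: "?\<alpha> * k1 r - ?\<beta> * k2 r \<le> (k1 r - k2 r) * ?u r + \<theta> r * ?J r" for r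
  proof -
    have "?\<alpha> * k1 r \<le> ?u r * k1 r"
    proof (cases "a \<le> r \<and> r \<le> a + e")
      case True
      then have "dist (?u r) (?u s) < \<epsilon>"
        using e st by (intro d1) (auto simp: a_def dist_real_def)
      then have "?\<alpha> \<le> ?u r" by (auto simp: dist_real_def)
      then show ?thesis using k0 e by (intro mult_right_mono) (auto simp: k1_def)
    next
      case False
      then have "k1 r = 0" using e by (auto simp: k1_def field_simps intro!: kz)
      then show ?thesis by simp
    qed
    moreover have "?u r * k2 r \<le> ?\<beta> * k2 r"
    proof (cases "b \<le> r \<and> r \<le> b + e")
      case True
      then have "dist (?u r) (?u t) < \<epsilon>"
        using e st by (intro d2) (auto simp: b_def dist_real_def)
      then have "?u r \<le> ?\<beta>" by (auto simp: dist_real_def)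
      then show ?thesis using k0 e by (intro mult_right_mono) (auto simp: k2_def)
    next
      case False
      then have "k2 r = 0" using e by (auto simp: k2_def field_simps intro!: kz)
      then show ?thesis by simp
    qed
    moreover have "0 \<le> \<theta> r * ?J r"
    proof (cases "a \<le> r \<and> r \<le> b + e")
      case True
      then have "0 \<le> ?J r" using e by (intro J) (auto simp: a_def b_def)
      then show ?thesis using \<theta>_nonneg by simp
    next
      case False
      then show ?thesis using \<theta>0 by simp
    qed
    ultimately show ?thesis by (simp add: algebra_simps)
  qed
  have "?\<alpha> * 1 - ?\<beta> * 1 =
      (\<integral>r. ?\<alpha> * (indicator {0<..} r *\<^sub>R k1 r) - ?\<beta> * (indicator {0<..} r *\<^sub>R k2 r) \<partial>lborel)"
    using has_bochner_integral_integral_eq[OF bumps] by simp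
  also have "\<dots> \<le> (LINT r:{0<..}|lborel. (k1 r - k2 r) * ?u r + \<theta> r * ?J r)"
    unfolding set_lebesgue_integral_def
    by (rule integral_mono)
      (use bumps loc(1) pw in \<open>auto simp: set_integrable_def has_bochner_integral_iff split: split_indicator\<close>)
  finally have "?\<alpha> \<le> ?\<beta>" using loc(2) by simp
  moreover have "3 * \<epsilon> = ?u s - ?u t" by (simp add: \<epsilon>_def)
  ultimately show False using \<epsilon> by linarith
qed

section \<open>From the potential to a confining force\<close>

text \<open>The diagonal is excluded from the integral that defines the velocity; giving the force the value
  \<open>0\<close> there allows integration over the whole space and makes the force odd.\<close>

definition force :: "('a::euclidean_space \<Rightarrow> real) \<Rightarrow> 'a \<Rightarrow> 'a" where
  "force W z = (if z = 0 then 0 else grad W z)"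

lemma velocity_eq_force: "velocity W \<mu> x = - (\<integral>y. force W (x - y) \<partial>\<mu>)"
  unfolding velocity_def set_lebesgue_integral_def force_def
  by (intro arg_cong[where f = uminus] Bochner_Integration.integral_cong) (auto split: split_indicator)

text \<open>All that the proof uses of the potential. The constant \<open>\<Lambda>\<close> limits the repulsion, and
  \<open>confining\<close> is the condition \<open>w' r * r \<longlongrightarrow> \<infinity>\<close>.\<close>

locale confining_force =
  fixes G :: "'a::euclidean_space \<Rightarrow> 'a" and c :: "real \<Rightarrow> real" and A \<Lambda> R\<^sub>a :: real
  assumes radial: "G z = c (norm z) *\<^sub>R z"
    and borel_G: "G \<in> borel_measurable borel"
    and linear_growth: "norm (G z) \<le> A * (1 + norm z)"
    and repulsion_bound: "0 < r \<Longrightarrow> - \<Lambda> \<le> c r"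
    and attractive: "0 < r \<Longrightarrow> R\<^sub>a \<le> r \<Longrightarrow> 0 \<le> c r"
    and confining: "\<exists>K. \<forall>r\<ge>K. M \<le> r\<^sup>2 * c r"
    and A_pos: "0 < A" and \<Lambda>_nonneg: "0 \<le> \<Lambda>"

lemma radial_profile_has_derivative:
  fixes W :: "'a::euclidean_space \<Rightarrow> real"
  assumes diff: "\<And>x. x \<noteq> 0 \<Longrightarrow> W differentiable (at x)" and W: "\<And>x. W x = w (norm x)" and r: "0 < r"
  shows "(w has_real_derivative deriv w r) (at r)"
proof -
  obtain e :: 'a where e: "e \<in> Basis" using nonempty_Basis by blast
  have "W differentiable (at (r *\<^sub>R e))" using r e by (intro diff) (auto simp: nonzero_Basis)
  then obtain D where D: "(W has_derivative D) (at (r *\<^sub>R e))" by (auto simp: differentiable_def)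
  have "((\<lambda>s. W (s *\<^sub>R e)) has_derivative (\<lambda>h. D (h *\<^sub>R e))) (at r)"
    by (rule has_derivative_compose[where f = "\<lambda>s. s *\<^sub>R e" and f' = "\<lambda>h. h *\<^sub>R e" and g = W])
      (use D in \<open>auto intro!: derivative_eq_intros\<close>)
  then have "(w has_derivative (\<lambda>h. D (h *\<^sub>R e))) (at r)"
    by (rule has_derivative_transform_within_open[of _ _ _ _ "{0<..}"])
      (use r e W in auto)
  then have "w differentiable (at r)" by (auto simp: differentiable_def)
  then show ?thesis by (simp add: DERIV_deriv_iff_real_differentiable)
qed

lemma grad_radial:
  fixes W :: "'a::euclidean_space \<Rightarrow> real"
  assumes diff: "\<And>x. x \<noteq> 0 \<Longrightarrow> W differentiable (at x)" and W: "\<And>x. W x = w (norm x)" and z: "z \<noteq> 0"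
  shows "grad W z = (deriv w (norm z) / norm z) *\<^sub>R z"
proof (rule grad_eqI)
  have w: "(w has_derivative (*) (deriv w (norm z))) (at (norm z))"
    using radial_profile_has_derivative[OF diff W, of "norm z"] z
    by (simp add: has_field_derivative_def)
  have "((\<lambda>x. w (norm x)) has_derivative (\<lambda>h. deriv w (norm z) * (sgn z \<bullet> h))) (at z)"
    by (rule has_derivative_compose[where f = norm and f' = "\<lambda>h. sgn z \<bullet> h" and g = w
        and g' = "(*) (deriv w (norm z))"])
      (use has_derivative_norm[OF z] w in \<open>auto simp: inner_commute\<close>)
  moreover have "(\<lambda>x. w (norm x)) = W" using W by auto
  ultimately show "GDERIV W z :> (deriv w (norm z) / norm z) *\<^sub>R z"
    by (simp add: gderiv_def sgn_div_norm inner_commute divide_inverse mult_ac)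
qed

text \<open>Along a line through the origin, \<open>\<phi> s = W (s *\<^sub>R e) - l / 2 * s\<^sup>2\<close> is convex and even, hence minimal
  at \<open>0\<close> and nondecreasing on the positive axis: this is the lower bound. The tangent at \<open>r\<close> lies below
  \<open>\<phi>\<close> at \<open>2 * r + 1\<close>, where \<open>\<phi>\<close> is at most quadratic: this is the upper bound.\<close>

lemma radial_profile_derivative_bounds:
  fixes W :: "'a::euclidean_space \<Rightarrow> real"
  assumes diff: "\<And>x. x \<noteq> 0 \<Longrightarrow> W differentiable (at x)" and W: "\<And>x. W x = w (norm x)" and W0: "W 0 = 0"
    and conv: "convex_on UNIV (\<lambda>x. W x - l / 2 * (norm x)\<^sup>2)"
    and C: "0 < C" "\<And>z. W z \<le> C * (1 + (norm z)\<^sup>2)" and r: "0 < r"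
  shows "l * r \<le> deriv w r" and "\<bar>deriv w r\<bar> \<le> (4 * C + 5 * \<bar>l\<bar>) * (1 + r)"
proof -
  obtain e :: 'a where e: "e \<in> Basis" using nonempty_Basis by blast
  define \<phi> where "\<phi> s = W (s *\<^sub>R e) - l / 2 * s\<^sup>2" for s :: real
  have ns: "norm (s *\<^sub>R e) = \<bar>s\<bar>" for s using e by simp
  have \<phi>_conv: "convex_on UNIV \<phi>"
  proof (rule convex_onI)
    fix t x y :: real assume t: "0 < t" "t < 1"
    have "W ((1 - t) *\<^sub>R (x *\<^sub>R e) + t *\<^sub>R (y *\<^sub>R e)) - l / 2 * (norm ((1 - t) *\<^sub>R (x *\<^sub>R e) + t *\<^sub>R (y *\<^sub>R e)))\<^sup>2
       \<le> (1 - t) * (W (x *\<^sub>R e) - l / 2 * (norm (x *\<^sub>R e))\<^sup>2) + t * (W (y *\<^sub>R e) - l / 2 * (norm (y *\<^sub>R e))\<^sup>2)"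
      using convex_onD[OF conv, of t "x *\<^sub>R e" "y *\<^sub>R e"] t by (simp only: UNIV_I less_imp_le)
    moreover have "(1 - t) *\<^sub>R (x *\<^sub>R e) + t *\<^sub>R (y *\<^sub>R e) = ((1 - t) *\<^sub>R x + t *\<^sub>R y) *\<^sub>R e"
      by (simp add: algebra_simps)
    ultimately show "\<phi> ((1 - t) *\<^sub>R x + t *\<^sub>R y) \<le> (1 - t) * \<phi> x + t * \<phi> y"
      by (simp only: \<phi>_def ns power2_abs)
  qed auto
  have \<phi>_even: "\<phi> (- s) = \<phi> s" for s by (simp add: \<phi>_def W)
  have \<phi>0: "\<phi> 0 = 0" by (simp add: \<phi>_def W0)
  have \<phi>_nonneg: "0 \<le> \<phi> s" for s
    using convex_onD[OF \<phi>_conv, of "1 / 2" s "- s"] \<phi>0 \<phi>_even by simp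
  have "((\<lambda>s. w s - l / 2 * s\<^sup>2) has_real_derivative deriv w r - l * r) (at r)"
    by (rule DERIV_cong[OF DERIV_diff[OF radial_profile_has_derivative[OF diff W r]]])
      (auto intro!: derivative_eq_intros)
  then have "(\<phi> has_real_derivative deriv w r - l * r) (at r)"
    by (rule has_field_derivative_transform_within_open[of _ _ _ "{0<..}"])
      (use r in \<open>auto simp: \<phi>_def W e\<close>)
  then have tangent: "(deriv w r - l * r) * (s - r) \<le> \<phi> s - \<phi> r" for s
    by (intro convex_on_imp_above_tangent[OF \<phi>_conv]) auto
  have "(deriv w r - l * r) * r \<ge> 0"
    using tangent[of 0] \<phi>_nonneg[of r] \<phi>0 by simp
  then show lower: "l * r \<le> deriv w r" using r by (simp add: zero_le_mult_iff)
  have "(deriv w r - l * r) * (1 + r) \<le> \<phi> (2 * r + 1)"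
    using tangent[of "2 * r + 1"] \<phi>_nonneg[of r] by (simp add: algebra_simps)
  also have "\<dots> \<le> (C + \<bar>l\<bar>) * (1 + (2 * r + 1)\<^sup>2)"
  proof -
    have "W ((2 * r + 1) *\<^sub>R e) \<le> C * (1 + (2 * r + 1)\<^sup>2)"
      using C(2)[of "(2 * r + 1) *\<^sub>R e"] by (simp only: ns power2_abs)
    moreover have "- (l / 2 * (2 * r + 1)\<^sup>2) \<le> \<bar>l\<bar> * (1 + (2 * r + 1)\<^sup>2)"
    proof -
      have "- (l / 2) * (2 * r + 1)\<^sup>2 \<le> \<bar>l\<bar> * (1 + (2 * r + 1)\<^sup>2)"
        by (intro mult_mono) auto
      then show ?thesis by simp
    qed
    ultimately show ?thesis unfolding \<phi>_def distrib_right by linarith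
  qed
  also have "\<dots> \<le> (C + \<bar>l\<bar>) * (4 * (1 + r)\<^sup>2)"
    using C(1) r by (intro mult_left_mono) (auto simp: power2_eq_square algebra_simps)
  finally have "(deriv w r - l * r) * (1 + r) \<le> (4 * (C + \<bar>l\<bar>) * (1 + r)) * (1 + r)"
    by (simp only: power2_eq_square mult_ac)
  then have "deriv w r - l * r \<le> 4 * (C + \<bar>l\<bar>) * (1 + r)"
    by (rule mult_right_le_imp_le) (use r in simp)
  moreover have "\<bar>l * r\<bar> \<le> \<bar>l\<bar> * (1 + r)" using r by (simp add: abs_mult mult_left_mono)
  ultimately show "\<bar>deriv w r\<bar> \<le> (4 * C + 5 * \<bar>l\<bar>) * (1 + r)"
    using lower C(1) r unfolding abs_le_iff
    by (auto simp: algebra_simps abs_if split: if_splits intro: order_trans[OF _ mult_nonneg_nonneg])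
qed

lemma confining_force_of_potential:
  fixes W :: "'a::euclidean_space \<Rightarrow> real"
  assumes "NL0 W" "NL1 W" "NL2 W" "NL_RAD W w" "NL_CONF w"
  obtains c A \<Lambda> R\<^sub>a where "confining_force (force W) c A \<Lambda> R\<^sub>a"
proof -
  have diff: "\<And>x. x \<noteq> 0 \<Longrightarrow> W differentiable (at x)" and cont: "continuous_on (- {0}) (grad W)"
    and W0: "W 0 = 0" using assms(1) by (auto simp: NL0_def)
  obtain l where conv: "convex_on UNIV (\<lambda>x. W x - l / 2 * (norm x)\<^sup>2)"
    using assms(2) by (auto simp: NL1_def)
  obtain C where C: "0 < C" "\<And>z. W z \<le> C * (1 + (norm z)\<^sup>2)"
    using assms(3) by (auto simp: NL2_def)
  obtain R\<^sub>a where W: "\<And>x. W x = w (norm x)" and Ra: "0 \<le> R\<^sub>a" "\<And>r. R\<^sub>a \<le> r \<Longrightarrow> 0 < r \<Longrightarrow> 0 \<le> deriv w r"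
    using assms(4) by (auto simp: NL_RAD_def)
  have bounds: "l * r \<le> deriv w r" "\<bar>deriv w r\<bar> \<le> (4 * C + 5 * \<bar>l\<bar>) * (1 + r)" if "0 < r" for r
    using radial_profile_derivative_bounds[OF diff W W0 conv C that] by auto
  define c where "c r = deriv w r / r" for r
  define A where "A = 4 * C + 5 * \<bar>l\<bar>"
  have A: "0 < A" using C by (simp add: A_def)
  have rad: "force W z = c (norm z) *\<^sub>R z" for z
    using grad_radial[OF diff W, of z] by (simp add: force_def c_def)
  have "confining_force (force W) c A \<bar>l\<bar> R\<^sub>a"
  proof
    show "force W \<in> borel_measurable borel"
      unfolding force_def[abs_def]
      using borel_measurable_continuous_on_if[of "{0}" "\<lambda>z. 0" "grad W"] cont by simp
    show "norm (force W z) \<le> A * (1 + norm z)" for z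
    proof (cases "z = 0")
      case False
      then show ?thesis using bounds(2)[of "norm z"] by (simp add: rad c_def A_def)
    qed (use A in \<open>simp add: force_def\<close>)
    show "- \<bar>l\<bar> \<le> c r" if "0 < r" for r
    proof -
      have "- \<bar>l\<bar> \<le> l" by simp
      also have "l \<le> c r" using bounds(1)[OF that] that by (simp add: c_def field_simps)
      finally show ?thesis .
    qed
    show "\<exists>K. \<forall>r\<ge>K. M \<le> r\<^sup>2 * c r" for M
    proof -
      have "eventually (\<lambda>r. M \<le> deriv w r * r) at_top"
        using assms(5) by (auto simp: NL_CONF_def filterlim_at_top)
      then obtain K where "\<And>r. K \<le> r \<Longrightarrow> M \<le> deriv w r * r" by (auto simp: eventually_at_top_linorder)
      then show ?thesis
        by (intro exI[of _ "max K 1"]) (auto simp: c_def power2_eq_square mult_ac)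
    qed
  qed (use rad A Ra in \<open>auto simp: c_def\<close>)
  then show ?thesis by (rule that)
qed

section \<open>The velocity field and finite speed of propagation\<close>

context confining_force
begin

definition field :: "'a measure \<Rightarrow> 'a \<Rightarrow> 'a" where
  "field \<mu> x = - (\<integral>y. G (x - y) \<partial>\<mu>)"

lemma G_measurable_shift:
  assumes "\<mu> \<in> P2"
  shows "(\<lambda>y. G (x - y)) \<in> borel_measurable \<mu>"
proof -
  have "(\<lambda>y. G (x - y)) \<in> borel_measurable borel"
    by (rule measurable_compose[OF _ borel_G]) simp
  then show ?thesis
    using P2D(2)[OF assms] by (simp cong: measurable_cong_sets)
qed

lemma norm_G_shift_le: "norm (G (x - y)) \<le> A * (1 + norm x + norm y)"
proof -
  have "norm (G (x - y)) \<le> A * (1 + norm (x - y))" by (rule linear_growth)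
  also have "\<dots> \<le> A * (1 + norm x + norm y)"
    using A_pos norm_triangle_ineq4[of x y] by (intro mult_left_mono) auto
  finally show ?thesis .
qed

lemma integrable_G_shift:
  assumes "\<mu> \<in> P2"
  shows "integrable \<mu> (\<lambda>y. G (x - y))"
proof -
  interpret prob_space \<mu> by (rule P2D(1)[OF assms])
  show ?thesis
  proof (rule Bochner_Integration.integrable_bound)
    show "integrable \<mu> (\<lambda>y. A * (1 + norm x + norm y))" using P2D(5)[OF assms] by simp
    show "(\<lambda>y. G (x - y)) \<in> borel_measurable \<mu>" by (rule G_measurable_shift[OF assms])
    show "AE y in \<mu>. norm (G (x - y)) \<le> norm (A * (1 + norm x + norm y))"
      using norm_G_shift_le A_pos by (intro always_eventually) (auto intro: order_trans[OF _ abs_ge_self])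
  qed
qed

lemma norm_field_le:
  assumes "\<mu> \<in> P2"
  shows "norm (field \<mu> x) \<le> A * (1 + norm x + (\<integral>y. norm y \<partial>\<mu>))"
proof -
  interpret prob_space \<mu> by (rule P2D(1)[OF assms])
  have "norm (field \<mu> x) \<le> (\<integral>y. norm (G (x - y)) \<partial>\<mu>)"
    unfolding field_def by (simp add: integral_norm_bound)
  also have "\<dots> \<le> (\<integral>y. A * (1 + norm x + norm y) \<partial>\<mu>)"
    using norm_G_shift_le integrable_G_shift[OF assms] P2D(5)[OF assms] by (intro integral_mono) auto
  also have "\<dots> = A * (1 + norm x + (\<integral>y. norm y \<partial>\<mu>))"
    using P2D(5)[OF assms] by (simp add: prob_space)
  finally show ?thesis .
qed

lemma borel_measurable_G_diff:
  assumes "\<mu> \<in> P2"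
  shows "(\<lambda>z. G (fst z - snd z)) \<in> borel_measurable (\<mu> \<Otimes>\<^sub>M \<mu>)"
proof -
  have "(\<lambda>z::'a \<times> 'a. fst z - snd z) \<in> borel_measurable borel"
    by (intro borel_measurable_continuous_onI continuous_intros)
  then have "(\<lambda>z. G (fst z - snd z)) \<in> borel_measurable borel"
    by (rule measurable_compose[OF _ borel_G])
  moreover have "sets (\<mu> \<Otimes>\<^sub>M \<mu>) = sets borel"
    using pair_coupling(1)[OF assms assms] by (simp add: couplings_def borel_prob_def)
  ultimately show ?thesis by (simp cong: measurable_cong_sets)
qed

lemma integrable_field:
  assumes "\<mu> \<in> P2"
  shows "integrable \<mu> (field \<mu>)"
proof -
  interpret prob_space \<mu> by (rule P2D(1)[OF assms])
  show ?thesis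
  proof (rule Bochner_Integration.integrable_bound)
    show "integrable \<mu> (\<lambda>x. A * (1 + norm x + (\<integral>y. norm y \<partial>\<mu>)))" using P2D(5)[OF assms] by simp
    have "(\<lambda>x. \<integral>y. G (x - y) \<partial>\<mu>) \<in> borel_measurable \<mu>"
      using borel_measurable_G_diff[OF assms]
      by (intro borel_measurable_lebesgue_integral) (simp add: case_prod_unfold)
    then show "field \<mu> \<in> borel_measurable \<mu>"
      unfolding field_def[abs_def] by simp
    show "AE x in \<mu>. norm (field \<mu> x) \<le> norm (A * (1 + norm x + (\<integral>y. norm y \<partial>\<mu>)))"
      using norm_field_le[OF assms] by (intro always_eventually) (auto intro: order_trans[OF _ abs_ge_self])
  qed
qed

end

locale confining_flow = confining_force G c A \<Lambda> R\<^sub>a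
  for G :: "'a::euclidean_space \<Rightarrow> 'a" and c A \<Lambda> R\<^sub>a +
  fixes \<rho> :: "real \<Rightarrow> 'a measure"
  assumes AC: "locally_AC_curve \<rho>" and CE: "continuity_equation \<rho> (\<lambda>t. field (\<rho> t))"
begin

lemma \<rho>_P2: "0 \<le> t \<Longrightarrow> \<rho> t \<in> P2"
  using AC by (rule locally_AC_curve_P2)

text \<open>No mass enters \<open>\<Psi> > 0\<close> if \<open>\<Psi>\<close> decreases along the velocity field in the thin layer
  \<open>0 < \<Psi> < 1\<close>. The test function \<open>1 - H \<circ> \<Psi>\<close> equals \<open>1\<close> where \<open>\<Psi> \<le> 0\<close>, and its integral, which does
  not exceed the total mass, starts at the total mass and does not decrease.\<close>

lemma barrier:
  assumes \<Psi>: "C_infinity \<Psi>"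
    and S: "\<And>t x. 0 \<le> t \<Longrightarrow> t \<le> T \<Longrightarrow> S < norm x \<Longrightarrow> 1 \<le> \<Psi> (t, x)"
    and init: "AE x in \<rho> 0. \<Psi> (0, x) \<le> 0"
    and decr: "\<And>r x. 0 < r \<Longrightarrow> r < T \<Longrightarrow> 0 < \<Psi> (r, x) \<Longrightarrow> \<Psi> (r, x) < 1 \<Longrightarrow>
        frechet_derivative \<Psi> (at (r, x)) (1, field (\<rho> r) x) \<le> 0"
    and t: "0 \<le> t" "t \<le> T"
  shows "AE x in \<rho> t. \<Psi> (t, x) \<le> 0"
proof -
  obtain H k :: "real \<Rightarrow> real" where Hs: "C_infinity H" and Hk: "\<And>x. (H has_real_derivative k x) (at x)"
    and kc: "continuous_on UNIV k" and k0: "\<And>x. 0 \<le> k x" and kz: "\<And>x. x \<le> 0 \<or> 1 \<le> x \<Longrightarrow> k x = 0"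
    and H0: "\<And>x. x \<le> 0 \<Longrightarrow> H x = 0" and H1: "\<And>x. 1 \<le> x \<Longrightarrow> H x = 1"
    and Hpos: "\<And>x. 0 < x \<Longrightarrow> 0 < H x" and Hm: "mono H"
    by (rule smooth_step_exists) (rule that)
  have Hnn: "0 \<le> H x" for x using H0[of x] Hpos[of x] by (cases "x \<le> 0") auto
  have Hle: "H x \<le> 1" for x
    using H1[of x] monoD[OF Hm, of x 1] H1[of 1] by (cases "1 \<le> x") auto
  define \<Phi> where "\<Phi> z = 1 - H (\<Psi> z)" for z
  have \<Phi>s: "C_infinity \<Phi>"
    unfolding \<Phi>_def[abs_def] by (intro C_infinity_diff C_infinity_const C_infinity_compose[OF Hs \<Psi>])
  have d: "frechet_derivative \<Phi> (at z) w = - (k (\<Psi> z) * frechet_derivative \<Psi> (at z) w)" for z w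
  proof -
    have "((\<lambda>z. H (\<Psi> z)) has_derivative (\<lambda>h. k (\<Psi> z) * frechet_derivative \<Psi> (at z) h)) (at z)"
    proof (rule has_derivative_compose[where f = \<Psi> and g = H and g' = "(*) (k (\<Psi> z))"])
      show "(\<Psi> has_derivative frechet_derivative \<Psi> (at z)) (at z)"
        by (rule C_infinity_derivative(1)[OF \<Psi>])
      show "(H has_derivative (*) (k (\<Psi> z))) (at (\<Psi> z))"
        using Hk[of "\<Psi> z"] by (simp only: has_field_derivative_def)
    qed
    from has_derivative_diff[OF has_derivative_const[of 1] this]
    have "(\<Phi> has_derivative (\<lambda>h. 0 - k (\<Psi> z) * frechet_derivative \<Psi> (at z) h)) (at z)"
      unfolding \<Phi>_def[abs_def] .
    from frechet_derivative_at[OF this, symmetric] show ?thesis by simp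
  qed
  have z: "\<Phi> (t, x) = 0" if "0 \<le> t" "t \<le> T" "S < norm x" for t x
    using S[OF that] by (simp add: \<Phi>_def H1)
  have mono: "(\<integral>x. \<Phi> (0, x) \<partial>\<rho> 0) \<le> (\<integral>x. \<Phi> (t, x) \<partial>\<rho> t)"
  proof (rule continuity_equation_monotone[OF AC CE \<Phi>s z])
    fix r assume r: "0 < r" "r < t"
    then show "integrable (\<rho> r) (field (\<rho> r))" by (intro integrable_field \<rho>_P2) simp
    show "0 \<le> (\<integral>x. frechet_derivative \<Phi> (at (r, x)) (1, field (\<rho> r) x) \<partial>\<rho> r)"
    proof (rule Bochner_Integration.integral_nonneg)
      fix x
      show "0 \<le> frechet_derivative \<Phi> (at (r, x)) (1, field (\<rho> r) x)"
      proof (cases "0 < \<Psi> (r, x) \<and> \<Psi> (r, x) < 1")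
        case True
        then have "frechet_derivative \<Psi> (at (r, x)) (1, field (\<rho> r) x) \<le> 0"
          using r t by (intro decr) auto
        then show ?thesis using k0 by (simp add: d mult_nonneg_nonpos)
      next
        case False
        then have "k (\<Psi> (r, x)) = 0" by (intro kz) auto
        then show ?thesis by (simp add: d)
      qed
    qed
  qed (use t in auto)
  interpret P0: prob_space "\<rho> 0" by (intro P2D(1) \<rho>_P2) simp
  interpret Pt: prob_space "\<rho> t" by (intro P2D(1) \<rho>_P2 t)
  have c\<Phi>: "continuous_on UNIV (\<lambda>x. \<Phi> (t, x))" for t
    by (rule continuous_on_compose2[OF C_infinity_derivative(3)[OF \<Phi>s]]) (auto intro: continuous_intros)
  have int: "integrable (\<rho> r) (\<lambda>x. \<Phi> (r, x))" if "0 \<le> r" for r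
    using Hnn Hle by (intro integrable_bounded_continuous[where B = 1] \<rho>_P2 that c\<Phi>) (auto simp: \<Phi>_def)
  have "(\<integral>x. \<Phi> (0, x) \<partial>\<rho> 0) = (\<integral>x. 1 \<partial>\<rho> 0)"
    using init by (intro integral_cong_AE borel_measurable_integrable int) (auto simp: \<Phi>_def H0)
  then have "1 \<le> (\<integral>x. \<Phi> (t, x) \<partial>\<rho> t)" using mono by (simp add: P0.prob_space)
  then have "(\<integral>x. 1 - \<Phi> (t, x) \<partial>\<rho> t) \<le> 0" using int[OF t(1)] by (simp add: Pt.prob_space)
  moreover have nn: "0 \<le> 1 - \<Phi> (t, x)" for x using Hnn by (simp add: \<Phi>_def)
  ultimately have "(\<integral>x. 1 - \<Phi> (t, x) \<partial>\<rho> t) = 0"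
    by (intro antisym Bochner_Integration.integral_nonneg)
  then have "AE x in \<rho> t. 1 - \<Phi> (t, x) = 0"
    using int[OF t(1)] nn by (subst (asm) integral_nonneg_eq_0_iff_AE) auto
  then show ?thesis
  proof (rule eventually_mono)
    fix x assume "1 - \<Phi> (t, x) = 0"
    then show "\<Psi> (t, x) \<le> 0" using Hpos[of "\<Psi> (t, x)"] unfolding \<Phi>_def by linarith
  qed
qed

lemma has_derivative_norm_sq_snd:
  "((\<lambda>z. snd z \<bullet> snd z) has_derivative (\<lambda>h. 2 * (snd z \<bullet> snd h))) (at (z :: real \<times> 'a))"
  by (auto intro!: derivative_eq_intros simp: inner_commute)

text \<open>The velocity grows at most linearly in space, locally uniformly in time, so the sublevel
  sets of \<open>exp (- b * t) * (1 + (norm x)\<^sup>2)\<close> expand at least as fast as the flow for suitable \<open>b\<close>.\<close>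

lemma finite_propagation:
  assumes R0: "AE x in \<rho> 0. norm x \<le> R0" and T: "0 \<le> T"
  obtains S where "\<And>t. 0 \<le> t \<Longrightarrow> t \<le> T \<Longrightarrow> AE x in \<rho> t. norm x \<le> S"
proof -
  obtain m where m: "\<And>t. 0 \<le> t \<Longrightarrow> t \<le> T \<Longrightarrow> (\<integral>x. norm x \<partial>\<rho> t) \<le> m"
    using first_moment_locally_bounded[OF AC T] by blast
  have "0 \<le> (\<integral>x. norm x \<partial>\<rho> 0)" by (rule Bochner_Integration.integral_nonneg) simp
  then have m0: "0 \<le> m" using m[of 0] T by linarith
  define b where "b = 4 * A * (1 + m)"
  have b: "0 \<le> b" using A_pos m0 by (simp add: b_def)
  define c1 where "c1 = 1 + R0\<^sup>2"
  define \<Psi> :: "real \<times> 'a \<Rightarrow> real" where "\<Psi> z = exp (- b * fst z) * (1 + snd z \<bullet> snd z) - c1" for z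
  define S where "S = exp (b * T) * (1 + c1)"
  have S1: "1 \<le> S"
    using mult_mono[of 1 "exp (b * T)" 1 "1 + c1"] b T by (simp add: S_def c1_def)
  have \<Psi>: "C_infinity \<Psi>"
    unfolding \<Psi>_def[abs_def]
    by (intro C_infinity_diff C_infinity_mult C_infinity_add C_infinity_const C_infinity_inner
        C_infinity_compose[OF C_infinity_exp] C_infinity_bounded_linear bounded_linear_fst bounded_linear_snd)
  have d: "frechet_derivative \<Psi> (at (r, x)) (1, w) = exp (- b * r) * (2 * (x \<bullet> w) - b * (1 + x \<bullet> x))" for r x w
  proof -
    have e: "((\<lambda>z :: real \<times> 'a. exp (- b * fst z)) has_derivative (\<lambda>h. exp (- b * r) * (- b * fst h))) (at (r, x))"
      by (auto intro!: derivative_eq_intros)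
    have n: "((\<lambda>z :: real \<times> 'a. 1 + snd z \<bullet> snd z) has_derivative (\<lambda>h. 2 * (x \<bullet> snd h))) (at (r, x))"
      using has_derivative_add[OF has_derivative_const has_derivative_norm_sq_snd, of 1 "(r, x)"] by simp
    have "(\<Psi> has_derivative (\<lambda>h. exp (- b * r) * (2 * (x \<bullet> snd h)) + exp (- b * r) * (- b * fst h) * (1 + x \<bullet> x)
        - 0)) (at (r, x))"
      unfolding \<Psi>_def[abs_def]
      using has_derivative_diff[OF has_derivative_mult[OF e n] has_derivative_const[of c1]] by simp
    from frechet_derivative_at[OF this, symmetric] show ?thesis by (simp add: algebra_simps)
  qed
  have large: "1 \<le> \<Psi> (t, x)" if t: "0 \<le> t" "t \<le> T" and x: "S < norm x" for t x
  proof -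
    have "S * 1 \<le> norm x * norm x" using x S1 by (intro mult_mono) auto
    then have "S \<le> 1 + x \<bullet> x" by (simp add: dot_square_norm power2_eq_square)
    then have "exp (- b * T) * S \<le> exp (- b * t) * (1 + x \<bullet> x)"
      using b t S1 by (intro mult_mono) (auto intro: mult_left_mono)
    then show ?thesis by (simp add: S_def \<Psi>_def mult.assoc[symmetric] exp_add[symmetric])
  qed
  show ?thesis
  proof (rule that)
    fix t assume t: "0 \<le> t" "t \<le> T"
    have "AE x in \<rho> t. \<Psi> (t, x) \<le> 0"
    proof (rule barrier[OF \<Psi> large _ _ t])
      show "AE x in \<rho> 0. \<Psi> (0, x) \<le> 0"
        using R0
      proof eventually_elim
        case (elim x)
        then have "(norm x)\<^sup>2 \<le> R0\<^sup>2" by (intro power_mono) auto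
        then show ?case by (simp add: \<Psi>_def c1_def dot_square_norm)
      qed
      fix r x assume r: "0 < r" "r < T"
      have "norm (field (\<rho> r) x) \<le> A * (1 + norm x + m)"
        using m[of r] r A_pos
        by (intro order_trans[OF norm_field_le[OF \<rho>_P2]] mult_left_mono) auto
      also have "\<dots> \<le> A * ((1 + m) * (1 + norm x))"
        using A_pos m0 by (intro mult_left_mono) (auto simp: algebra_simps)
      finally have "norm x * norm (field (\<rho> r) x) \<le> norm x * (A * ((1 + m) * (1 + norm x)))"
        by (intro mult_left_mono) auto
      then have "2 * (x \<bullet> field (\<rho> r) x) \<le> 2 * (norm x * (A * ((1 + m) * (1 + norm x))))"
        using norm_cauchy_schwarz[of x "field (\<rho> r) x"] by linarith
      also have "\<dots> = (2 * A * (1 + m)) * (norm x * (1 + norm x))" by (simp add: algebra_simps)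
      also have "\<dots> \<le> (2 * A * (1 + m)) * (2 * (1 + (norm x)\<^sup>2))"
      proof (rule mult_left_mono)
        have "2 * norm x \<le> 1 + (norm x)\<^sup>2"
          using zero_le_power2[of "norm x - 1"] by (simp add: power2_diff)
        then have "norm x + (norm x)\<^sup>2 \<le> 2 * (1 + (norm x)\<^sup>2)"
          using zero_le_power2[of "norm x"] by argo
        then show "norm x * (1 + norm x) \<le> 2 * (1 + (norm x)\<^sup>2)"
          by (simp only: distrib_left power2_eq_square mult_1_right)
      qed (use A_pos m0 in simp)
      also have "\<dots> = b * (1 + x \<bullet> x)" by (simp add: b_def dot_square_norm)
      finally show "frechet_derivative \<Psi> (at (r, x)) (1, field (\<rho> r) x) \<le> 0"
        unfolding d by (intro mult_nonneg_nonpos) auto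
    qed auto
    then show "AE x in \<rho> t. norm x \<le> S"
    proof (rule eventually_mono)
      fix x assume "\<Psi> (t, x) \<le> 0"
      then show "norm x \<le> S" using large[OF t, of x] by linarith
    qed
  qed
qed

end

section \<open>Symmetrised interactions\<close>

lemma AE_pair_norm_le:
  assumes \<mu>: "\<mu> \<in> P2" and R: "AE x in \<mu>. norm x \<le> R"
  shows "AE z in \<mu> \<Otimes>\<^sub>M \<mu>. norm (fst z) \<le> R \<and> norm (snd z) \<le> R"
proof -
  have m: "fst \<in> measurable (\<mu> \<Otimes>\<^sub>M \<mu>) borel" "snd \<in> measurable (\<mu> \<Otimes>\<^sub>M \<mu>) borel"
    using measurable_fst[of \<mu> \<mu>] measurable_snd[of \<mu> \<mu>] P2D(2)[OF \<mu>] by (simp_all cong: measurable_cong_sets)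
  have d: "distr (\<mu> \<Otimes>\<^sub>M \<mu>) borel fst = \<mu>" "distr (\<mu> \<Otimes>\<^sub>M \<mu>) borel snd = \<mu>"
    using pair_coupling(1)[OF \<mu> \<mu>] by (simp_all add: couplings_def)
  have meas: "{x \<in> space borel. norm x \<le> R} \<in> sets (borel :: 'a measure)" by simp
  have "AE z in \<mu> \<Otimes>\<^sub>M \<mu>. norm (fst z) \<le> R"
    using AE_distr_iff[OF m(1) meas, unfolded d] R by (rule iffD1)
  moreover have "AE z in \<mu> \<Otimes>\<^sub>M \<mu>. norm (snd z) \<le> R"
    using AE_distr_iff[OF m(2) meas, unfolded d] R by (rule iffD1)
  ultimately show ?thesis by eventually_elim simp
qed

lemma integral_pair_marginal:
  fixes f :: "'a::euclidean_space \<Rightarrow> 'b::{banach, second_countable_topology}"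
  assumes \<mu>: "\<mu> \<in> P2" and f: "integrable \<mu> f"
  shows "integrable (\<mu> \<Otimes>\<^sub>M \<mu>) (\<lambda>z. f (fst z))" "(\<integral>z. f (fst z) \<partial>(\<mu> \<Otimes>\<^sub>M \<mu>)) = (\<integral>x. f x \<partial>\<mu>)"
    "integrable (\<mu> \<Otimes>\<^sub>M \<mu>) (\<lambda>z. f (snd z))" "(\<integral>z. f (snd z) \<partial>(\<mu> \<Otimes>\<^sub>M \<mu>)) = (\<integral>x. f x \<partial>\<mu>)"
proof -
  have m: "fst \<in> measurable (\<mu> \<Otimes>\<^sub>M \<mu>) borel" "snd \<in> measurable (\<mu> \<Otimes>\<^sub>M \<mu>) borel"
    using measurable_fst[of \<mu> \<mu>] measurable_snd[of \<mu> \<mu>] P2D(2)[OF \<mu>] by (simp_all cong: measurable_cong_sets)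
  have d: "distr (\<mu> \<Otimes>\<^sub>M \<mu>) borel fst = \<mu>" "distr (\<mu> \<Otimes>\<^sub>M \<mu>) borel snd = \<mu>"
    using pair_coupling(1)[OF \<mu> \<mu>] by (simp_all add: couplings_def)
  have fb: "f \<in> borel_measurable borel"
    using f P2D(2)[OF \<mu>] by (auto cong: measurable_cong_sets)
  show "integrable (\<mu> \<Otimes>\<^sub>M \<mu>) (\<lambda>z. f (fst z))" "(\<integral>z. f (fst z) \<partial>(\<mu> \<Otimes>\<^sub>M \<mu>)) = (\<integral>x. f x \<partial>\<mu>)"
    "integrable (\<mu> \<Otimes>\<^sub>M \<mu>) (\<lambda>z. f (snd z))" "(\<integral>z. f (snd z) \<partial>(\<mu> \<Otimes>\<^sub>M \<mu>)) = (\<integral>x. f x \<partial>\<mu>)"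
    using integrable_distr_eq[OF m(1) fb] integrable_distr_eq[OF m(2) fb]
      integral_distr[OF m(1) fb] integral_distr[OF m(2) fb] f by (simp_all add: d)
qed

text \<open>The identity that turns attraction between distant pairs into a multiple of the second moment.\<close>

lemma integral_pair_dist_sq:
  fixes \<mu> :: "'a::euclidean_space measure"
  assumes \<mu>: "\<mu> \<in> P2"
  shows "integrable (\<mu> \<Otimes>\<^sub>M \<mu>) (\<lambda>z. (norm (fst z - snd z))\<^sup>2)"
    and "(\<integral>z. (norm (fst z - snd z))\<^sup>2 \<partial>(\<mu> \<Otimes>\<^sub>M \<mu>)) = 2 * (\<integral>x. (norm x)\<^sup>2 \<partial>\<mu>) - 2 * (norm (\<integral>x. x \<partial>\<mu>))\<^sup>2"
proof -
  interpret M: prob_space \<mu> by (rule P2D(1)[OF \<mu>])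
  interpret MM: pair_prob_space \<mu> \<mu> ..
  let ?P = "\<mu> \<Otimes>\<^sub>M \<mu>"
  have id: "integrable \<mu> (\<lambda>x. x)" by (rule P2_integrable_id[OF \<mu>])
  note sq = integral_pair_marginal[OF \<mu> P2D(3)[OF \<mu>]]
  note idp = integral_pair_marginal[OF \<mu> id]
  have exp: "fst z \<bullet> snd z = ((norm (fst z))\<^sup>2 + (norm (snd z))\<^sup>2 - (norm (fst z - snd z))\<^sup>2) / 2" for z :: "'a \<times> 'a"
    by (simp add: power2_norm_eq_inner inner_diff_left inner_diff_right inner_commute)
  have ip: "integrable ?P (\<lambda>z. fst z \<bullet> snd z)"
  proof (rule Bochner_Integration.integrable_bound)
    show "integrable ?P (\<lambda>z. (norm (fst z))\<^sup>2 + (norm (snd z))\<^sup>2)"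
      using sq by simp
    show "(\<lambda>z. fst z \<bullet> snd z) \<in> borel_measurable ?P"
      using borel_measurable_integrable[OF idp(1)] borel_measurable_integrable[OF idp(3)]
      by (rule borel_measurable_inner)
    have "\<bar>fst z \<bullet> snd z\<bar> \<le> (norm (fst z))\<^sup>2 + (norm (snd z))\<^sup>2" for z :: "'a \<times> 'a"
    proof -
      have "\<bar>fst z \<bullet> snd z\<bar> \<le> norm (fst z) * norm (snd z)" by (rule Cauchy_Schwarz_ineq2)
      also have "\<dots> \<le> (norm (fst z))\<^sup>2 + (norm (snd z))\<^sup>2"
        using sum_squares_bound[of "norm (fst z)" "norm (snd z)"] mult_nonneg_nonneg[OF norm_ge_zero norm_ge_zero, of "fst z" "snd z"]
        by linarith
      finally show ?thesis .
    qed
    then show "AE z in ?P. norm (fst z \<bullet> snd z) \<le> norm ((norm (fst z))\<^sup>2 + (norm (snd z))\<^sup>2)"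
      by (intro always_eventually) (simp add: order_trans[OF _ abs_ge_self])
  qed
  have "(\<integral>z. fst z \<bullet> snd z \<partial>?P) = (\<integral>x. (\<integral>y. x \<bullet> y \<partial>\<mu>) \<partial>\<mu>)"
    using MM.integral_fst'[of "\<lambda>z. fst z \<bullet> snd z"] ip by simp
  also have "\<dots> = (norm (\<integral>x. x \<partial>\<mu>))\<^sup>2"
    using id by (simp add: dot_square_norm)
  finally have ip2: "(\<integral>z. fst z \<bullet> snd z \<partial>?P) = (norm (\<integral>x. x \<partial>\<mu>))\<^sup>2" .
  have eq: "(norm (fst z - snd z))\<^sup>2 = (norm (fst z))\<^sup>2 + (norm (snd z))\<^sup>2 - 2 * (fst z \<bullet> snd z)" for z :: "'a \<times> 'a"
    using exp[of z] by simp
  show "integrable ?P (\<lambda>z. (norm (fst z - snd z))\<^sup>2)"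
    unfolding eq using sq ip by simp
  show "(\<integral>z. (norm (fst z - snd z))\<^sup>2 \<partial>?P) = 2 * (\<integral>x. (norm x)\<^sup>2 \<partial>\<mu>) - 2 * (norm (\<integral>x. x \<partial>\<mu>))\<^sup>2"
    unfolding eq using sq ip ip2 by simp
qed

context confining_force
begin

lemma G_odd: "G (y - x) = - G (x - y)"
  by (simp add: radial norm_minus_commute[of y x] flip: scaleR_minus_right)

text \<open>The force is odd, so exchanging the two particles antisymmetrises the test vector field. With a constant
  \<open>f\<close> this is conservation of the center of mass.\<close>

lemma integral_inner_field_symmetrized:
  fixes f :: "'a \<Rightarrow> 'a"
  assumes \<mu>: "\<mu> \<in> P2" and R: "AE x in \<mu>. norm x \<le> R" and f: "continuous_on UNIV f"
  shows "integrable (\<mu> \<Otimes>\<^sub>M \<mu>) (\<lambda>z. (f (fst z) - f (snd z)) \<bullet> G (fst z - snd z))"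
    and "2 * (\<integral>x. f x \<bullet> field \<mu> x \<partial>\<mu>) = - (\<integral>z. (f (fst z) - f (snd z)) \<bullet> G (fst z - snd z) \<partial>(\<mu> \<Otimes>\<^sub>M \<mu>))"
proof -
  interpret M: prob_space \<mu> by (rule P2D(1)[OF \<mu>])
  interpret MM: pair_prob_space \<mu> \<mu> ..
  let ?P = "\<mu> \<Otimes>\<^sub>M \<mu>"
  let ?h = "\<lambda>z. f (fst z) \<bullet> G (fst z - snd z)"
  have "compact (f ` cball 0 R)"
    by (intro compact_continuous_image continuous_on_subset[OF f]) auto
  then obtain B where B: "0 < B" "\<And>y. y \<in> f ` cball 0 R \<Longrightarrow> norm y \<le> B"
    using compact_imp_bounded bounded_pos by metis
  have fm: "f \<in> borel_measurable \<mu>"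
    using borel_measurable_continuous_onI[OF f] P2D(2)[OF \<mu>] by (simp cong: measurable_cong_sets)
  have hm: "?h \<in> borel_measurable ?P"
    using measurable_compose[OF measurable_fst fm, of \<mu>] borel_measurable_G_diff[OF \<mu>]
    by (rule borel_measurable_inner)
  have hi: "integrable ?P ?h"
  proof (rule MM.P.integrable_const_bound[OF _ hm])
    show "AE z in ?P. norm (?h z) \<le> B * (A * (1 + R + R))"
      using AE_pair_norm_le[OF \<mu> R]
    proof eventually_elim
      case (elim z)
      have "norm (?h z) \<le> norm (f (fst z)) * norm (G (fst z - snd z))"
        by (simp add: Cauchy_Schwarz_ineq2)
      also have "\<dots> \<le> B * (A * (1 + R + R))"
      proof (rule mult_mono)
        show "norm (f (fst z)) \<le> B" using elim by (intro B(2)) auto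
        have "norm (G (fst z - snd z)) \<le> A * (1 + norm (fst z) + norm (snd z))" by (rule norm_G_shift_le)
        also have "\<dots> \<le> A * (1 + R + R)" using elim A_pos by (intro mult_left_mono) auto
        finally show "norm (G (fst z - snd z)) \<le> A * (1 + R + R)" .
      qed (use B in auto)
      finally show ?case .
    qed
  qed
  have hs: "integrable ?P (\<lambda>z. ?h (snd z, fst z))" "(\<integral>z. ?h (snd z, fst z) \<partial>?P) = (\<integral>z. ?h z \<partial>?P)"
    using MM.integrable_product_swap[OF hi] MM.integral_product_swap[OF hm]
    by (simp_all add: case_prod_unfold)
  have eq: "(f (fst z) - f (snd z)) \<bullet> G (fst z - snd z) = ?h z + ?h (snd z, fst z)" for z
    using G_odd[of "snd z" "fst z"] by (simp add: inner_diff_left)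
  show "integrable ?P (\<lambda>z. (f (fst z) - f (snd z)) \<bullet> G (fst z - snd z))"
    unfolding eq by (intro Bochner_Integration.integrable_add hi hs)
  have "(\<integral>z. ?h z \<partial>?P) = (\<integral>x. (\<integral>y. f x \<bullet> G (x - y) \<partial>\<mu>) \<partial>\<mu>)"
    using MM.integral_fst'[OF hi] by simp
  also have "\<dots> = (\<integral>x. - (f x \<bullet> field \<mu> x) \<partial>\<mu>)"
    using integrable_G_shift[OF \<mu>] by (simp add: field_def)
  finally have "(\<integral>x. f x \<bullet> field \<mu> x \<partial>\<mu>) = - (\<integral>z. ?h z \<partial>?P)" by simp
  then show "2 * (\<integral>x. f x \<bullet> field \<mu> x \<partial>\<mu>) = - (\<integral>z. (f (fst z) - f (snd z)) \<bullet> G (fst z - snd z) \<partial>?P)"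
    unfolding eq using hi hs by simp
qed

text \<open>With \<open>s = (norm x)\<^sup>2 + (norm y)\<^sup>2\<close>, the right-hand side equals \<open>c r * q\<close> where \<open>q\<close> lies between
  \<open>s * r\<^sup>2 / 2\<close> and \<open>3 / 2 * s * r\<^sup>2\<close>. At distances below \<open>R\<^sub>a\<close> this loses at most
  \<open>3 / 2 * \<Lambda> * R\<^sub>a\<^sup>2 * s\<close>; beyond \<open>K\<close> it gains \<open>M * s / 2\<close>, and \<open>s\<close> is at least half of \<open>r\<^sup>2\<close>; in
  between it is nonnegative.\<close>

lemma quartic_interaction_bound:
  assumes M: "0 \<le> M" and K: "0 < K" "R\<^sub>a \<le> K" "\<And>r. K \<le> r \<Longrightarrow> M \<le> r\<^sup>2 * c r"
  shows "- (3 / 2) * \<Lambda> * R\<^sub>a\<^sup>2 * ((norm x)\<^sup>2 + (norm y)\<^sup>2) + M / 4 * ((norm (x - y))\<^sup>2 - K\<^sup>2)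
     \<le> ((norm x)\<^sup>2 *\<^sub>R x - (norm y)\<^sup>2 *\<^sub>R y) \<bullet> G (x - y)"
proof -
  define r where "r = norm (x - y)"
  define s where "s = (norm x)\<^sup>2 + (norm y)\<^sup>2"
  define q where "q = s * r\<^sup>2 / 2 + ((norm x)\<^sup>2 - (norm y)\<^sup>2)\<^sup>2 / 2"
  have s0: "0 \<le> s" and q0: "0 \<le> q" by (simp_all add: s_def q_def)
  have r0: "0 \<le> r" by (simp add: r_def)
  have r2: "r\<^sup>2 = s - 2 * (x \<bullet> y)"
    by (simp add: r_def s_def power2_norm_eq_inner inner_diff_left inner_diff_right inner_commute)
  have "((norm x)\<^sup>2 *\<^sub>R x - (norm y)\<^sup>2 *\<^sub>R y) \<bullet> (x - y) = q"
    unfolding q_def r2 s_def power2_norm_eq_inner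
    by (simp add: inner_diff_left inner_diff_right inner_commute[of y x] power2_eq_square field_simps)
  then have eq: "((norm x)\<^sup>2 *\<^sub>R x - (norm y)\<^sup>2 *\<^sub>R y) \<bullet> G (x - y) = c r * q"
    by (simp add: radial r_def)
  have r2le: "r\<^sup>2 \<le> 2 * s"
  proof -
    have "r\<^sup>2 \<le> (norm x + norm y)\<^sup>2" unfolding r_def by (intro power_mono norm_triangle_ineq4) simp
    also have "\<dots> \<le> 2 * s" using sum_squares_bound[of "norm x" "norm y"] by (simp add: s_def power2_sum)
    finally show ?thesis .
  qed
  have qle: "q \<le> 3 / 2 * s * r\<^sup>2"
  proof -
    have "((norm x)\<^sup>2 - (norm y)\<^sup>2)\<^sup>2 = (norm x + norm y)\<^sup>2 * (norm x - norm y)\<^sup>2"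
      by (simp add: power2_eq_square algebra_simps)
    also have "\<dots> \<le> (2 * s) * r\<^sup>2"
    proof (rule mult_mono)
      show "(norm x + norm y)\<^sup>2 \<le> 2 * s"
        using sum_squares_bound[of "norm x" "norm y"] by (simp add: s_def power2_sum)
      show "(norm x - norm y)\<^sup>2 \<le> r\<^sup>2"
        unfolding r_def by (simp add: abs_le_square_iff[symmetric] norm_triangle_ineq3)
    qed (use s0 in auto)
    finally show ?thesis by (simp add: q_def algebra_simps)
  qed
  let ?rep = "(3 / 2) * \<Lambda> * R\<^sub>a\<^sup>2 * s"
  have rep0: "0 \<le> ?rep" using \<Lambda>_nonneg s0 by simp
  have "- ?rep + M / 4 * (r\<^sup>2 - K\<^sup>2) \<le> c r * q"
  proof (cases "K \<le> r")
    case True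
    then have r_pos: "0 < r" and c0: "0 \<le> c r" using K by (auto intro!: attractive)
    have "M / 4 * (r\<^sup>2 - K\<^sup>2) \<le> M / 4 * (2 * s)"
      using M r2le by (intro mult_left_mono) (auto intro: order_trans[OF diff_le_self] simp: diff_le_eq add_increasing2)
    also have "\<dots> \<le> (r\<^sup>2 * c r) * (s / 2)"
      using mult_right_mono[OF K(3)[OF True], of "s / 2"] s0 by simp
    also have "\<dots> \<le> c r * q"
      using mult_left_mono[of "s * r\<^sup>2 / 2" q "c r"] c0 by (simp add: q_def algebra_simps)
    finally show ?thesis using rep0 by linarith
  next
    case False
    then have "r\<^sup>2 \<le> K\<^sup>2" using r0 by (intro power_mono) auto
    then have neg: "M / 4 * (r\<^sup>2 - K\<^sup>2) \<le> 0" using M by (simp add: mult_nonneg_nonpos)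
    have "- ?rep \<le> c r * q"
    proof (cases "r = 0 \<or> R\<^sub>a \<le> r")
      case True
      then have "0 \<le> c r * q"
      proof
        assume "r = 0"
        then have "q = 0" using qle q0 by simp
        then show ?thesis by simp
      next
        assume "R\<^sub>a \<le> r"
        show ?thesis
        proof (cases "r = 0")
          case True
          then have "q = 0" using qle q0 by simp
          then show ?thesis by simp
        next
          case False
          then show ?thesis using attractive[of r] \<open>R\<^sub>a \<le> r\<close> r0 q0 by simp
        qed
      qed
      then show ?thesis using rep0 by linarith
    next
      case False
      then have r: "0 < r" "r < R\<^sub>a" using r0 by auto
      have "\<Lambda> * q \<le> \<Lambda> * (3 / 2 * s * R\<^sub>a\<^sup>2)"
      proof (rule mult_left_mono[OF order_trans[OF qle] \<Lambda>_nonneg])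
        have "r\<^sup>2 \<le> R\<^sub>a\<^sup>2" using r by (intro power_mono) auto
        then show "3 / 2 * s * r\<^sup>2 \<le> 3 / 2 * s * R\<^sub>a\<^sup>2" using s0 by (intro mult_left_mono) auto
      qed
      moreover have "- \<Lambda> * q \<le> c r * q" using repulsion_bound[OF r(1)] q0 by (intro mult_right_mono)
      ultimately show ?thesis by (simp add: mult_ac)
    qed
    then show ?thesis using neg by linarith
  qed
  then show ?thesis by (simp add: eq r_def s_def)
qed

end

section \<open>Moments along the flow\<close>

context confining_flow
begin

text \<open>Polynomials are not compactly supported, but as long as the measures live in a fixed ball they can be
  replaced by functions that vanish outside a larger ball and have the same integrals and the same
  derivatives on the fixed one.\<close>

lemma moment_cutoff:
  fixes F :: "'a \<Rightarrow> real"
  assumes F: "C_infinity F"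
  obtains \<Phi> :: "real \<times> 'a \<Rightarrow> real" and S where "C_infinity \<Phi>" "\<And>t x. S < norm x \<Longrightarrow> \<Phi> (t, x) = 0"
    "\<And>t. 0 \<le> t \<Longrightarrow> AE x in \<rho> t. norm x \<le> R \<Longrightarrow> (\<integral>x. \<Phi> (t, x) \<partial>\<rho> t) = (\<integral>x. F x \<partial>\<rho> t)"
    "\<And>t x v. norm x \<le> R \<Longrightarrow> frechet_derivative \<Phi> (at (t, x)) (1, v) = frechet_derivative F (at x) v"
proof -
  obtain H k :: "real \<Rightarrow> real" where Hs: "C_infinity H" and Hk: "\<And>x. (H has_real_derivative k x) (at x)"
    and kc: "continuous_on UNIV k" and k0: "\<And>x. 0 \<le> k x" and kz: "\<And>x. x \<le> 0 \<or> 1 \<le> x \<Longrightarrow> k x = 0"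
    and H0: "\<And>x. x \<le> 0 \<Longrightarrow> H x = 0" and H1: "\<And>x. 1 \<le> x \<Longrightarrow> H x = 1"
    and Hpos: "\<And>x. 0 < x \<Longrightarrow> 0 < H x" and Hm: "mono H"
    by (rule smooth_step_exists) (rule that)
  define \<psi> :: "real \<times> 'a \<Rightarrow> real" where "\<psi> z = snd z \<bullet> snd z - R\<^sup>2" for z
  have \<psi>s: "C_infinity \<psi>"
    unfolding \<psi>_def[abs_def] by (intro C_infinity_diff C_infinity_const C_infinity_inner bounded_linear_snd)
  define \<Phi> where "\<Phi> z = F (snd z) * (1 - H (\<psi> z))" for z
  have Fs: "C_infinity (\<lambda>z :: real \<times> 'a. F (snd z))"
    by (rule C_infinity_snd[OF F])
  have inside: "\<psi> (t, x) \<le> 0" if "norm x \<le> R" for t x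
    using power_mono[OF that, of 2] by (simp add: \<psi>_def power2_norm_eq_inner)
  have \<Phi>s: "C_infinity \<Phi>"
    unfolding \<Phi>_def[abs_def]
    by (intro C_infinity_mult Fs C_infinity_diff C_infinity_const C_infinity_compose[OF Hs \<psi>s])
  show ?thesis
  proof (rule that[of \<Phi> "R\<^sup>2 + 1"])
    show "C_infinity \<Phi>" by (rule \<Phi>s)
    show "\<Phi> (t, x) = 0" if "R\<^sup>2 + 1 < norm x" for t x
    proof -
      have "norm x * 1 \<le> norm x * norm x" using that by (intro mult_left_mono) (auto intro: order_trans[of _ "R\<^sup>2 + 1"])
      then have "1 \<le> \<psi> (t, x)" using that
        by (simp add: \<psi>_def power2_norm_eq_inner[symmetric] power2_eq_square[of "norm x"])
      then show ?thesis by (simp add: \<Phi>_def H1)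
    qed
    show "(\<integral>x. \<Phi> (t, x) \<partial>\<rho> t) = (\<integral>x. F x \<partial>\<rho> t)" if t: "0 \<le> t" and R: "AE x in \<rho> t. norm x \<le> R" for t
    proof (rule integral_cong_AE)
      have s: "sets (\<rho> t) = sets borel" by (intro P2D(2) \<rho>_P2 t)
      show "F \<in> borel_measurable (\<rho> t)"
        using borel_measurable_continuous_onI[OF C_infinity_derivative(3)[OF F]] s
        by (simp cong: measurable_cong_sets)
      have "continuous_on UNIV (\<lambda>x. \<Phi> (t, x))"
        by (rule continuous_on_compose2[OF C_infinity_derivative(3)[OF \<Phi>s]]) (auto intro: continuous_intros)
      from borel_measurable_continuous_onI[OF this] show "(\<lambda>x. \<Phi> (t, x)) \<in> borel_measurable (\<rho> t)"
        using s by (simp cong: measurable_cong_sets)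
      show "AE x in \<rho> t. \<Phi> (t, x) = F x"
        using R
      proof (rule eventually_mono)
        fix x :: 'a assume "norm x \<le> R"
        from inside[OF this, of t] show "\<Phi> (t, x) = F x" by (simp add: \<Phi>_def H0)
      qed
    qed
    fix t and x v :: 'a assume x: "norm x \<le> R"
    have h: "((\<lambda>z. H (\<psi> z)) has_derivative (\<lambda>h. k (\<psi> (t, x)) * frechet_derivative \<psi> (at (t, x)) h)) (at (t, x))"
    proof (rule has_derivative_compose[where f = \<psi> and g = H and g' = "(*) (k (\<psi> (t, x)))"])
      show "(\<psi> has_derivative frechet_derivative \<psi> (at (t, x))) (at (t, x))"
        by (rule C_infinity_derivative(1)[OF \<psi>s])
      show "(H has_derivative (*) (k (\<psi> (t, x)))) (at (\<psi> (t, x)))"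
        using Hk[of "\<psi> (t, x)"] by (simp only: has_field_derivative_def)
    qed
    have f: "((\<lambda>z. F (snd z)) has_derivative (\<lambda>h. frechet_derivative F (at x) (snd h))) (at (t, x))"
      by (rule has_derivative_compose[where f = snd and f' = snd and g = F])
        (use C_infinity_derivative(1)[OF F, of x] in \<open>auto intro: bounded_linear_imp_has_derivative bounded_linear_snd\<close>)
    from has_derivative_mult[OF f has_derivative_diff[OF has_derivative_const[of 1] h]]
    have "(\<Phi> has_derivative (\<lambda>h. F x * (0 - k (\<psi> (t, x)) * frechet_derivative \<psi> (at (t, x)) h) +
        frechet_derivative F (at x) (snd h) * (1 - H (\<psi> (t, x))))) (at (t, x))"
      unfolding \<Phi>_def[abs_def] by simp
    from frechet_derivative_at[OF this, symmetric]
    show "frechet_derivative \<Phi> (at (t, x)) (1, v) = frechet_derivative F (at x) v"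
      using inside[OF x] by (simp add: kz H0)
  qed
qed

lemma borel_measurable_inner_field:
  assumes "\<mu> \<in> P2" "continuous_on UNIV f"
  shows "(\<lambda>x. f x \<bullet> field \<mu> x) \<in> borel_measurable \<mu>"
proof -
  have "f \<in> borel_measurable \<mu>"
    using borel_measurable_continuous_onI[OF assms(2)] P2D(2)[OF assms(1)] by (simp cong: measurable_cong_sets)
  then show ?thesis
    using borel_measurable_integrable[OF integrable_field[OF assms(1)]] by (rule borel_measurable_inner)
qed

lemma moment_continuous:
  assumes F: "C_infinity F" and T: "0 \<le> T" and R: "\<And>t. 0 \<le> t \<Longrightarrow> t \<le> T \<Longrightarrow> AE x in \<rho> t. norm x \<le> R"
  shows "continuous_on {0..T} (\<lambda>t. \<integral>x. F x \<partial>\<rho> t)"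
proof -
  obtain \<Phi> :: "real \<times> 'a \<Rightarrow> real" and S where \<Phi>: "C_infinity \<Phi>"
    and z: "\<And>t x. S < norm x \<Longrightarrow> \<Phi> (t, x) = 0"
    and eq: "\<And>t. 0 \<le> t \<Longrightarrow> AE x in \<rho> t. norm x \<le> R \<Longrightarrow> (\<integral>x. \<Phi> (t, x) \<partial>\<rho> t) = (\<integral>x. F x \<partial>\<rho> t)"
    using moment_cutoff[OF F, where R = R] by metis
  have "continuous_on {0..T} (\<lambda>t. \<integral>x. \<Phi> (t, x) \<partial>\<rho> t)"
    by (rule continuous_integral_along_curve[OF AC T C_infinity_derivative(3)[OF \<Phi>] z])
  moreover have "(\<integral>x. \<Phi> (t, x) \<partial>\<rho> t) = (\<integral>x. F x \<partial>\<rho> t)" if "t \<in> {0..T}" for t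
    using that by (intro eq R) auto
  ultimately show ?thesis
    using continuous_on_cong[of "{0..T}" "{0..T}" "\<lambda>t. \<integral>x. \<Phi> (t, x) \<partial>\<rho> t" "\<lambda>t. \<integral>x. F x \<partial>\<rho> t"]
    by (simp only: simp_thms)
qed

lemma moment_monotone:
  assumes F: "C_infinity F" and f: "\<And>x v. frechet_derivative F (at x) v = f x \<bullet> v" and fc: "continuous_on UNIV f"
    and R: "\<And>r. s \<le> r \<Longrightarrow> r \<le> t \<Longrightarrow> AE x in \<rho> r. norm x \<le> R"
    and st: "0 \<le> s" "s \<le> t"
    and J: "\<And>r. s < r \<Longrightarrow> r < t \<Longrightarrow> 0 \<le> (\<integral>x. f x \<bullet> field (\<rho> r) x \<partial>\<rho> r)"
  shows "(\<integral>x. F x \<partial>\<rho> s) \<le> (\<integral>x. F x \<partial>\<rho> t)"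
proof -
  obtain \<Phi> :: "real \<times> 'a \<Rightarrow> real" and S where \<Phi>: "C_infinity \<Phi>"
    and z: "\<And>t x. S < norm x \<Longrightarrow> \<Phi> (t, x) = 0"
    and eq: "\<And>t. 0 \<le> t \<Longrightarrow> AE x in \<rho> t. norm x \<le> R \<Longrightarrow> (\<integral>x. \<Phi> (t, x) \<partial>\<rho> t) = (\<integral>x. F x \<partial>\<rho> t)"
    and deq: "\<And>t x v. norm x \<le> R \<Longrightarrow> frechet_derivative \<Phi> (at (t, x)) (1, v) = frechet_derivative F (at x) v"
    by (rule moment_cutoff[OF F, of R]) (rule that)
  have "(\<integral>x. \<Phi> (s, x) \<partial>\<rho> s) \<le> (\<integral>x. \<Phi> (t, x) \<partial>\<rho> t)"
  proof (rule continuity_equation_monotone[OF AC CE \<Phi>])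
    show "\<Phi> (r, x) = 0" if "0 \<le> r" "r \<le> t + 1" "S < norm x" for r x using z that by simp
    fix r assume r: "s < r" "r < t"
    then have \<mu>: "\<rho> r \<in> P2" using st by (intro \<rho>_P2) simp
    show "integrable (\<rho> r) (field (\<rho> r))" by (rule integrable_field[OF \<mu>])
    have "integrable (\<rho> r) (\<lambda>x. frechet_derivative \<Phi> (at (r, x)) (1, field (\<rho> r) x))"
      by (rule integrable_derivative_along[OF \<mu> \<Phi> integrable_field[OF \<mu>], of "t + 1" S]) (use z r st in auto)
    then have "(\<integral>x. frechet_derivative \<Phi> (at (r, x)) (1, field (\<rho> r) x) \<partial>\<rho> r) = (\<integral>x. f x \<bullet> field (\<rho> r) x \<partial>\<rho> r)"
      using R[of r] r
      by (intro integral_cong_AE borel_measurable_integrable borel_measurable_inner_field[OF \<mu> fc])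
        (auto elim!: eventually_mono simp: deq f)
    then show "0 \<le> (\<integral>x. frechet_derivative \<Phi> (at (r, x)) (1, field (\<rho> r) x) \<partial>\<rho> r)"
      using J[OF r] by simp
  qed (use st in auto)
  then show ?thesis using eq[OF _ R, of s] eq[OF _ R, of t] st by simp
qed

lemma center_of_mass_conserved:
  assumes R: "\<And>r. 0 \<le> r \<Longrightarrow> r \<le> t \<Longrightarrow> AE x in \<rho> r. norm x \<le> R" and t: "0 \<le> t"
  shows "(\<integral>x. x \<partial>\<rho> t) = (\<integral>x. x \<partial>\<rho> 0)"
proof -
  have le: "(\<integral>x. x \<bullet> e \<partial>\<rho> 0) \<le> (\<integral>x. x \<bullet> e \<partial>\<rho> t)" for e
  proof (rule moment_monotone[where f = "\<lambda>x. e"])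
    show "C_infinity (\<lambda>x. x \<bullet> e)" by (intro C_infinity_bounded_linear bounded_linear_inner_left)
    have "((\<lambda>x. x \<bullet> e) has_derivative (\<lambda>v. v \<bullet> e)) (at x)" for x
      by (intro bounded_linear_imp_has_derivative bounded_linear_inner_left)
    from frechet_derivative_at[OF this, symmetric]
    show "frechet_derivative (\<lambda>x. x \<bullet> e) (at x) v = e \<bullet> v" for x v by (simp add: inner_commute)
    fix r assume r: "0 < r" "r < t"
    have "2 * (\<integral>x. e \<bullet> field (\<rho> r) x \<partial>\<rho> r) = 0"
      using integral_inner_field_symmetrized(2)[OF \<rho>_P2 R, of r "\<lambda>x. e"] r by simp
    then show "0 \<le> (\<integral>x. e \<bullet> field (\<rho> r) x \<partial>\<rho> r)" by simp
  qed (use R t in auto)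
  have id: "integrable (\<rho> r) (\<lambda>x. x)" if "0 \<le> r" for r
    by (intro P2_integrable_id \<rho>_P2 that)
  have "(\<integral>x. x \<partial>\<rho> 0) \<bullet> e \<le> (\<integral>x. x \<partial>\<rho> t) \<bullet> e" for e
    using le[of e] id[of 0] id[OF t] by simp
  from this[of "(\<integral>x. x \<partial>\<rho> 0) - (\<integral>x. x \<partial>\<rho> t)"]
  have "((\<integral>x. x \<partial>\<rho> 0) - (\<integral>x. x \<partial>\<rho> t)) \<bullet> ((\<integral>x. x \<partial>\<rho> 0) - (\<integral>x. x \<partial>\<rho> t)) \<le> 0"
    by (simp add: inner_diff_left)
  then show ?thesis by (metis inner_ge_zero antisym inner_eq_zero_iff right_minus_eq)
qed

end

context confining_force
begin

text \<open>The factor \<open>6 * \<Lambda> * R\<^sub>a\<^sup>2 + 2\<close> is chosen so that half of it, the coefficient of the second moment gained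
  from attraction, exceeds the loss \<open>3 * \<Lambda> * R\<^sub>a\<^sup>2\<close> from repulsion by exactly \<open>1\<close>.\<close>

lemma quartic_dissipation:
  assumes \<mu>: "\<mu> \<in> P2" and R: "AE x in \<mu>. norm x \<le> R"
    and K: "0 < K" "R\<^sub>a \<le> K" "\<And>r. K \<le> r \<Longrightarrow> 6 * \<Lambda> * R\<^sub>a\<^sup>2 + 2 \<le> r\<^sup>2 * c r"
    and cm: "norm (\<integral>x. x \<partial>\<mu>) \<le> D"
  shows "2 * (\<integral>x. ((norm x)\<^sup>2 *\<^sub>R x) \<bullet> field \<mu> x \<partial>\<mu>) \<le>
     (6 * \<Lambda> * R\<^sub>a\<^sup>2 + 2) / 4 * (2 * D\<^sup>2 + K\<^sup>2) - (\<integral>x. (norm x)\<^sup>2 \<partial>\<mu>)"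
proof -
  interpret M: prob_space \<mu> by (rule P2D(1)[OF \<mu>])
  interpret MM: pair_prob_space \<mu> \<mu> ..
  let ?P = "\<mu> \<Otimes>\<^sub>M \<mu>"
  define M where "M = 6 * \<Lambda> * R\<^sub>a\<^sup>2 + 2"
  have M0: "0 \<le> M" using \<Lambda>_nonneg by (simp add: M_def)
  define L where "L = - (3 / 2) * \<Lambda> * R\<^sub>a\<^sup>2"
  define m2 where "m2 = (\<integral>x. (norm x)\<^sup>2 \<partial>\<mu>)"
  note sq = integral_pair_marginal[OF \<mu> P2D(3)[OF \<mu>]] and ds = integral_pair_dist_sq[OF \<mu>]
  have fc: "continuous_on UNIV (\<lambda>x :: 'a. (norm x)\<^sup>2 *\<^sub>R x)" by (intro continuous_intros)
  note sym = integral_inner_field_symmetrized[OF \<mu> R fc]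
  have lower: "L * (2 * m2) + M / 4 * (2 * m2 - 2 * (norm (\<integral>x. x \<partial>\<mu>))\<^sup>2 - K\<^sup>2) =
      (\<integral>z. L * ((norm (fst z))\<^sup>2 + (norm (snd z))\<^sup>2) + M / 4 * ((norm (fst z - snd z))\<^sup>2 - K\<^sup>2) \<partial>?P)"
    using sq ds by (simp add: m2_def MM.P.prob_space)
  also have "\<dots> \<le> (\<integral>z. ((norm (fst z))\<^sup>2 *\<^sub>R fst z - (norm (snd z))\<^sup>2 *\<^sub>R snd z) \<bullet> G (fst z - snd z) \<partial>?P)"
  proof (rule integral_mono[OF _ sym(1)])
    show "integrable ?P (\<lambda>z. L * ((norm (fst z))\<^sup>2 + (norm (snd z))\<^sup>2) + M / 4 * ((norm (fst z - snd z))\<^sup>2 - K\<^sup>2))"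
      using sq ds by simp
    show "L * ((norm (fst z))\<^sup>2 + (norm (snd z))\<^sup>2) + M / 4 * ((norm (fst z - snd z))\<^sup>2 - K\<^sup>2)
       \<le> ((norm (fst z))\<^sup>2 *\<^sub>R fst z - (norm (snd z))\<^sup>2 *\<^sub>R snd z) \<bullet> G (fst z - snd z)" for z
      unfolding L_def by (rule quartic_interaction_bound[OF M0 K(1,2) K(3)[folded M_def]])
  qed
  finally have "2 * (\<integral>x. ((norm x)\<^sup>2 *\<^sub>R x) \<bullet> field \<mu> x \<partial>\<mu>) \<le>
      - (L * (2 * m2) + M / 4 * (2 * m2 - 2 * (norm (\<integral>x. x \<partial>\<mu>))\<^sup>2 - K\<^sup>2))"
    using sym(2) by linarith
  also have "\<dots> = M / 4 * (2 * (norm (\<integral>x. x \<partial>\<mu>))\<^sup>2 + K\<^sup>2) - m2"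
    unfolding L_def M_def by (simp add: field_simps)
  also have "\<dots> \<le> M / 4 * (2 * D\<^sup>2 + K\<^sup>2) - m2"
    using M0 power_mono[OF cm, of 2] by (intro diff_right_mono mult_left_mono) auto
  finally show ?thesis by (simp only: M_def m2_def)
qed

end

section \<open>Uniform confinement\<close>

context confining_flow
begin

text \<open>While the fourth moment exceeds \<open>C0 * R\<^sup>2\<close>, the second moment exceeds \<open>C0\<close> and the fourth moment
  does not increase. So after the last time at which it was below the bound it cannot have risen
  above it.\<close>

lemma fourth_moment_bound:
  assumes R: "\<And>t. 0 \<le> t \<Longrightarrow> t \<le> T \<Longrightarrow> AE x in \<rho> t. norm x \<le> R"
    and R0: "AE x in \<rho> 0. norm x \<le> R0" "0 \<le> R0"
    and K: "0 < K" "R\<^sub>a \<le> K" "\<And>r. K \<le> r \<Longrightarrow> 6 * \<Lambda> * R\<^sub>a\<^sup>2 + 2 \<le> r\<^sup>2 * c r"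
    and C0: "C0 = (6 * \<Lambda> * R\<^sub>a\<^sup>2 + 2) / 4 * (2 * R0\<^sup>2 + K\<^sup>2)"
    and t: "0 \<le> t" "t \<le> T"
  shows "(\<integral>x. norm x ^ 4 \<partial>\<rho> t) \<le> max (R0 ^ 4) (C0 * R\<^sup>2)"
proof (rule ccontr)
  define F where "F x = (x \<bullet> x) * (x \<bullet> x)" for x :: 'a
  have F_norm: "F x = norm x ^ 4" for x
    by (simp add: F_def power2_norm_eq_inner[symmetric] power2_eq_square power4_eq_xxxx)
  have F: "C_infinity F"
    unfolding F_def[abs_def] by (intro C_infinity_mult C_infinity_inner bounded_linear_ident)
  let ?f = "\<lambda>x :: 'a. (norm x)\<^sup>2 *\<^sub>R x"
  have F_deriv: "frechet_derivative F (at x) v = (4 *\<^sub>R ?f x) \<bullet> v" for x v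
  proof -
    have n: "((\<lambda>x. x \<bullet> x) has_derivative (\<lambda>h. 2 * (x \<bullet> h))) (at x)"
      by (auto intro!: derivative_eq_intros simp: inner_commute)
    from has_derivative_mult[OF n n]
    have "(F has_derivative (\<lambda>h. (x \<bullet> x) * (2 * (x \<bullet> h)) + 2 * (x \<bullet> h) * (x \<bullet> x))) (at x)"
      by (simp only: F_def[abs_def])
    from frechet_derivative_at[OF this, symmetric] show ?thesis
      by (simp add: power2_norm_eq_inner)
  qed
  have fc: "continuous_on UNIV (\<lambda>x. 4 *\<^sub>R ?f x)" by (intro continuous_intros)
  define L where "L = max (R0 ^ 4) (C0 * R\<^sup>2)"
  let ?u = "\<lambda>t. \<integral>x. F x \<partial>\<rho> t"
  assume "\<not> ?thesis"
  then have big: "L < ?u t" by (simp only: L_def F_norm not_le)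
  have int_F: "integrable (\<rho> r) F" if r: "0 \<le> r" "r \<le> T" for r
  proof -
    interpret P: prob_space "\<rho> r" by (intro P2D(1) \<rho>_P2 r)
    show ?thesis
    proof (rule P.integrable_const_bound)
      show "AE x in \<rho> r. norm (F x) \<le> R ^ 4"
        using R[OF r] by eventually_elim (simp add: F_norm power_mono)
      show "F \<in> borel_measurable (\<rho> r)"
        using borel_measurable_continuous_onI[OF C_infinity_derivative(3)[OF F]] P2D(2)[OF \<rho>_P2[OF r(1)]]
        by (simp cong: measurable_cong_sets)
    qed
  qed
  interpret P0: prob_space "\<rho> 0" by (intro P2D(1) \<rho>_P2) simp
  have init: "?u 0 \<le> L"
  proof -
    have "?u 0 \<le> (\<integral>x. R0 ^ 4 \<partial>\<rho> 0)"
      using R0(1) t by (intro integral_mono_AE int_F) (auto elim!: eventually_mono simp: F_norm power_mono)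
    then show ?thesis by (simp add: P0.prob_space L_def)
  qed
  have id: "integrable (\<rho> 0) (\<lambda>x. x)"
    by (intro P2_integrable_id \<rho>_P2) simp
  have cm0: "norm (\<integral>x. x \<partial>\<rho> 0) \<le> R0"
  proof -
    have "norm (\<integral>x. x \<partial>\<rho> 0) \<le> (\<integral>x. norm x \<partial>\<rho> 0)" by (rule integral_norm_bound)
    also have "\<dots> \<le> (\<integral>x. R0 \<partial>\<rho> 0)"
      using R0(1) id by (intro integral_mono_AE) auto
    finally show ?thesis by (simp add: P0.prob_space)
  qed
  have cont: "continuous_on {0..t} ?u"
    by (rule moment_continuous[OF F t(1), of R]) (use R t in auto)
  \<comment> \<open>\<open>s\<close> is the last time up to \<open>t\<close> at which the bound holds; it exists by continuity.\<close>
  define Z where "Z = {s \<in> {0..t}. ?u s \<le> L}"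
  have "Z = {0..t} \<inter> ?u -` {..L}" by (auto simp: Z_def)
  then have "closed Z" using continuous_closed_preimage[OF cont closed_atLeastAtMost closed_atMost] by simp
  have Z: "0 \<in> Z" "bdd_above Z" using init t by (auto simp: Z_def)
  define s where "s = Sup Z"
  have "s \<in> Z"
    unfolding s_def by (intro closed_contains_Sup) (use Z \<open>closed Z\<close> in auto)
  then have s: "0 \<le> s" "s \<le> t" "?u s \<le> L" by (auto simp: Z_def)
  have above: "L < ?u r" if "s < r" "r < t" for r
  proof (rule ccontr)
    assume "\<not> L < ?u r"
    then have "r \<in> Z" using that s by (auto simp: Z_def)
    then have "r \<le> s" unfolding s_def using Z(2) by (intro cSup_upper)
    then show False using that by simp
  qed
  have negF: "C_infinity (\<lambda>x. - F x)" by (rule C_infinity_minus[OF F])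
  have "(\<integral>x. - F x \<partial>\<rho> s) \<le> (\<integral>x. - F x \<partial>\<rho> t)"
  proof (rule moment_monotone[OF negF, where f = "\<lambda>x. - (4 *\<^sub>R ?f x)" and R = R])
    show "frechet_derivative (\<lambda>x. - F x) (at x) v = - (4 *\<^sub>R ?f x) \<bullet> v" for x v
    proof -
      have "((\<lambda>x. - F x) has_derivative (\<lambda>v. - frechet_derivative F (at x) v)) (at x)"
        by (rule has_derivative_minus[OF C_infinity_derivative(1)[OF F]])
      from frechet_derivative_at[OF this, symmetric] show ?thesis by (simp add: F_deriv)
    qed
    show "continuous_on UNIV (\<lambda>x. - (4 *\<^sub>R ?f x))" by (intro continuous_on_minus fc)
    fix r assume r: "s < r" "r < t"
    then have r0: "0 \<le> r" "r \<le> T" using s t by auto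
    note \<mu> = \<rho>_P2[OF r0(1)]
    have "norm (\<integral>x. x \<partial>\<rho> r) \<le> R0"
      using center_of_mass_conserved[of r R] R r0 cm0 by auto
    from quartic_dissipation[OF \<mu> R[OF r0] K this]
    have diss: "2 * (\<integral>x. ?f x \<bullet> field (\<rho> r) x \<partial>\<rho> r) \<le> C0 - (\<integral>x. (norm x)\<^sup>2 \<partial>\<rho> r)"
      by (simp add: C0)
    have "?u r \<le> (\<integral>x. R\<^sup>2 * (norm x)\<^sup>2 \<partial>\<rho> r)"
    proof (rule integral_mono_AE)
      show "AE x in \<rho> r. F x \<le> R\<^sup>2 * (norm x)\<^sup>2"
        using R[OF r0]
      proof eventually_elim
        case (elim x)
        have "(norm x)\<^sup>2 * (norm x)\<^sup>2 \<le> R\<^sup>2 * (norm x)\<^sup>2"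
          using elim by (intro mult_right_mono power_mono) auto
        then show ?case by (simp add: F_def power2_norm_eq_inner)
      qed
    qed (use int_F[OF r0] P2D(3)[OF \<mu>] in auto)
    also have "\<dots> = R\<^sup>2 * (\<integral>x. (norm x)\<^sup>2 \<partial>\<rho> r)" by simp
    finally have "C0 * R\<^sup>2 < R\<^sup>2 * (\<integral>x. (norm x)\<^sup>2 \<partial>\<rho> r)"
      using above[OF r] by (simp add: L_def)
    then have "C0 < (\<integral>x. (norm x)\<^sup>2 \<partial>\<rho> r)"
      by (simp add: mult.commute[of C0] mult_less_cancel_left)
    then have "(\<integral>x. ?f x \<bullet> field (\<rho> r) x \<partial>\<rho> r) \<le> 0" using diss by linarith
    moreover have "(\<integral>x. - (4 *\<^sub>R ?f x) \<bullet> field (\<rho> r) x \<partial>\<rho> r) = (\<integral>x. (- 4) * (?f x \<bullet> field (\<rho> r) x) \<partial>\<rho> r)"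
      by (intro Bochner_Integration.integral_cong) simp_all
    ultimately show "0 \<le> (\<integral>x. - (4 *\<^sub>R ?f x) \<bullet> field (\<rho> r) x \<partial>\<rho> r)"
      by (simp only: integral_mult_right_zero)
  qed (use R s t in auto)
  then have "?u t \<le> ?u s" by simp
  then show False using big s by simp
qed

end

context confining_force
begin

text \<open>Particles \<open>y\<close> in the inner ball \<open>norm y \<le> r / 2\<close> pull \<open>x\<close> inwards by at least \<open>N\<close>, the others push it
  outwards by at most \<open>B\<close>. On the latter \<open>16 * norm y ^ 4 / r ^ 4\<close> is at least \<open>1\<close>, so a single
  pointwise lower bound \<open>N - D * norm y ^ 4\<close> covers both kinds and is integrated with the help of the
  fourth moment. The numerical constants balance the result to \<open>0\<close>.\<close>

lemma field_points_inward:
  assumes \<mu>: "\<mu> \<in> P2" and supp: "AE y in \<mu>. norm y \<le> 2 * r"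
    and m4: "(\<integral>y. norm y ^ 4 \<partial>\<mu>) \<le> C1 * r\<^sup>2" and C1: "0 \<le> C1"
    and K: "\<And>s. K \<le> s \<Longrightarrow> 1440 * A * C1 \<le> s\<^sup>2 * c s"
    and r: "1 \<le> r" "2 * K \<le> r" "32 * C1 \<le> r\<^sup>2" and x: "r \<le> norm x" "norm x \<le> 2 * r"
  shows "x \<bullet> field \<mu> x \<le> 0"
proof -
  interpret prob_space \<mu> by (rule P2D(1)[OF \<mu>])
  define N where "N = 320 * A * C1"
  have N0: "0 \<le> N" using A_pos C1 by (simp add: N_def)
  define B where "B = 10 * A * r\<^sup>2"
  have B0: "0 \<le> B" using A_pos by (simp add: B_def)
  define D where "D = (N + B) * 16 / r ^ 4"
  have D0: "0 \<le> D" using N0 B0 by (simp add: D_def)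
  have int4: "integrable \<mu> (\<lambda>y. norm y ^ 4)"
  proof (rule integrable_const_bound)
    show "AE y in \<mu>. norm (norm y ^ 4) \<le> (2 * r) ^ 4"
      using supp
    proof (rule eventually_mono)
      fix y :: 'a assume "norm y \<le> 2 * r"
      from power_mono[OF this norm_ge_zero, of 4] show "norm (norm y ^ 4) \<le> (2 * r) ^ 4" by simp
    qed
    have "(\<lambda>y :: 'a. norm y ^ 4) \<in> borel_measurable borel" by measurable
    then show "(\<lambda>y. norm y ^ 4) \<in> borel_measurable \<mu>"
      using P2D(2)[OF \<mu>] by (simp cong: measurable_cong_sets)
  qed
  have "AE y in \<mu>. N - D * norm y ^ 4 \<le> x \<bullet> G (x - y)"
    using supp
  proof eventually_elim
    case (elim y)
    define s where "s = norm (x - y)"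
    show ?case
    proof (cases "norm y \<le> r / 2")
      case True
      have xy: "x \<bullet> y \<le> norm x * norm y" by (rule norm_cauchy_schwarz)
      also have "\<dots> \<le> norm x * (norm x / 2)" using True x by (intro mult_left_mono) auto
      finally have inner: "(norm x)\<^sup>2 / 2 \<le> x \<bullet> (x - y)"
        by (simp add: inner_diff_right power2_norm_eq_inner[symmetric] power2_eq_square)
      have s_ge: "r / 2 \<le> s"
        using norm_triangle_ineq2[of x y] True x unfolding s_def by linarith
      have s_le: "s \<le> 3 / 2 * norm x"
        using norm_triangle_ineq4[of x y] True x unfolding s_def by linarith
      have s_pos: "0 < s" using s_ge r by linarith
      have "9 / 2 * N \<le> s\<^sup>2 * c s" using K[of s] s_ge r by (simp add: N_def)
      then have cs: "9 / 2 * N / s\<^sup>2 \<le> c s" using s_pos by (simp add: field_simps)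
      have c0: "0 \<le> c s" using cs N0 by (intro order_trans[OF _ cs]) simp
      have "s\<^sup>2 \<le> (3 / 2 * norm x)\<^sup>2" using s_le s_pos by (intro power_mono) auto
      then have "N \<le> 9 / 2 * N / s\<^sup>2 * ((norm x)\<^sup>2 / 2)"
        using s_pos mult_left_mono[of "s\<^sup>2" "(3 / 2 * norm x)\<^sup>2" N] N0
        by (simp add: field_simps power_mult_distrib)
      also have "\<dots> \<le> c s * (x \<bullet> (x - y))"
        using cs c0 inner by (intro mult_mono) auto
      finally have "N \<le> x \<bullet> G (x - y)" by (simp add: radial s_def)
      moreover have "0 \<le> D * norm y ^ 4" using D0 by simp
      ultimately show ?thesis by linarith
    next
      case False
      then have "r ^ 4 \<le> (2 * norm y) ^ 4" using r by (intro power_mono) auto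
      then have "r ^ 4 \<le> 16 * norm y ^ 4" by (simp add: power_mult_distrib)
      then have "(N + B) * r ^ 4 \<le> (N + B) * (16 * norm y ^ 4)" using N0 B0 by (intro mult_left_mono) auto
      then have "N + B \<le> D * norm y ^ 4" using r by (simp add: D_def field_simps)
      moreover have "- (x \<bullet> G (x - y)) \<le> B"
      proof -
        have "- (x \<bullet> G (x - y)) \<le> norm x * norm (G (x - y))"
          using Cauchy_Schwarz_ineq2[of x "G (x - y)"] by linarith
        also have "\<dots> \<le> (2 * r) * (A * (1 + 2 * r + 2 * r))"
        proof (rule mult_mono)
          have "norm (G (x - y)) \<le> A * (1 + norm x + norm y)" by (rule norm_G_shift_le)
          also have "\<dots> \<le> A * (1 + 2 * r + 2 * r)" using elim x A_pos by (intro mult_left_mono) auto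
          finally show "norm (G (x - y)) \<le> A * (1 + 2 * r + 2 * r)" .
        qed (use x r in auto)
        also have "\<dots> \<le> (2 * r) * (A * (5 * r))" using r A_pos by (intro mult_left_mono) auto
        also have "\<dots> = B" by (simp add: B_def power2_eq_square)
        finally show ?thesis .
      qed
      ultimately show ?thesis by linarith
    qed
  qed
  then have "(\<integral>y. N - D * norm y ^ 4 \<partial>\<mu>) \<le> (\<integral>y. x \<bullet> G (x - y) \<partial>\<mu>)"
    using int4 integrable_G_shift[OF \<mu>] by (intro integral_mono_AE) auto
  then have le: "N - D * (\<integral>y. norm y ^ 4 \<partial>\<mu>) \<le> - (x \<bullet> field \<mu> x)"
    using int4 integrable_G_shift[OF \<mu>] by (simp add: prob_space field_def)
  have "D * (\<integral>y. norm y ^ 4 \<partial>\<mu>) \<le> D * (C1 * r\<^sup>2)" using m4 D0 by (rule mult_left_mono)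
  also have "\<dots> \<le> N"
  proof -
    have r4: "r ^ 4 = r\<^sup>2 * r\<^sup>2" by (simp add: power2_eq_square power4_eq_xxxx)
    have "D * (C1 * r\<^sup>2) = (N + B) * 16 * C1 / r\<^sup>2"
      using r unfolding D_def r4 by (simp add: field_simps)
    also have "\<dots> = N * (16 * C1 / r\<^sup>2) + 160 * A * C1"
      using r by (simp add: B_def field_simps)
    also have "\<dots> \<le> N * (1 / 2) + 160 * A * C1"
      using r N0 by (intro add_right_mono mult_left_mono) (auto simp: field_simps)
    also have "\<dots> = N" by (simp add: N_def)
    finally show ?thesis .
  qed
  finally show ?thesis using le by linarith
qed

end

context confining_flow
begin

lemma support_halving:
  assumes supp: "\<And>t. 0 \<le> t \<Longrightarrow> t \<le> T \<Longrightarrow> AE x in \<rho> t. norm x \<le> 2 * r"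
    and m4: "\<And>t. 0 \<le> t \<Longrightarrow> t \<le> T \<Longrightarrow> (\<integral>y. norm y ^ 4 \<partial>\<rho> t) \<le> C1 * r\<^sup>2" and C1: "0 \<le> C1"
    and K: "\<And>s. K \<le> s \<Longrightarrow> 1440 * A * C1 \<le> s\<^sup>2 * c s"
    and r: "1 \<le> r" "2 * K \<le> r" "32 * C1 \<le> r\<^sup>2" and init: "AE x in \<rho> 0. norm x \<le> r"
    and t: "0 \<le> t" "t \<le> T"
  shows "AE x in \<rho> t. norm x \<le> r"
proof -
  define \<Psi> :: "real \<times> 'a \<Rightarrow> real" where "\<Psi> z = snd z \<bullet> snd z - r\<^sup>2" for z
  have \<Psi>s: "C_infinity \<Psi>"
    unfolding \<Psi>_def[abs_def] by (intro C_infinity_diff C_infinity_const C_infinity_inner bounded_linear_snd)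
  have \<Psi>_norm: "\<Psi> (s, x) = (norm x)\<^sup>2 - r\<^sup>2" for s x by (simp add: \<Psi>_def power2_norm_eq_inner)
  have d: "frechet_derivative \<Psi> (at (s, x)) (1, v) = 2 * (x \<bullet> v)" for s x v
  proof -
    have "(\<Psi> has_derivative (\<lambda>h. 2 * (x \<bullet> snd h) - 0)) (at (s, x))"
      unfolding \<Psi>_def[abs_def]
      using has_derivative_diff[OF has_derivative_norm_sq_snd[of "(s, x)"] has_derivative_const[of "r\<^sup>2"]] by simp
    from frechet_derivative_at[OF this, symmetric] show ?thesis by simp
  qed
  have "AE x in \<rho> t. \<Psi> (t, x) \<le> 0"
  proof (rule barrier[OF \<Psi>s _ _ _ t])
    show "1 \<le> \<Psi> (s, x)" if "2 * r < norm x" for s x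
    proof -
      have "(2 * r)\<^sup>2 \<le> (norm x)\<^sup>2" using that r by (intro power_mono) auto
      moreover have "1 \<le> r\<^sup>2" using r by simp
      ultimately show ?thesis by (simp add: \<Psi>_norm power_mult_distrib)
    qed
    show "AE x in \<rho> 0. \<Psi> (0, x) \<le> 0"
      using init by eventually_elim (simp add: \<Psi>_norm power_mono)
    fix s x assume s: "0 < s" "s < T" and x: "0 < \<Psi> (s, x)" "\<Psi> (s, x) < 1"
    have "r \<le> norm x" by (rule power2_le_imp_le) (use x in \<open>auto simp: \<Psi>_norm\<close>)
    moreover have "norm x \<le> 2 * r"
    proof (rule power2_le_imp_le)
      have "1 \<le> r\<^sup>2" using r by simp
      then show "(norm x)\<^sup>2 \<le> (2 * r)\<^sup>2" using x by (simp add: \<Psi>_norm power_mult_distrib)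
    qed (use r in simp)
    ultimately have "x \<bullet> field (\<rho> s) x \<le> 0"
      using s by (intro field_points_inward[OF \<rho>_P2 supp m4 C1 K r]) auto
    then show "frechet_derivative \<Psi> (at (s, x)) (1, field (\<rho> s) x) \<le> 0" by (simp add: d)
  qed
  then show ?thesis
  proof (rule eventually_mono)
    fix x assume "\<Psi> (t, x) \<le> 0"
    then show "norm x \<le> r" using r by (intro power2_le_imp_le[of "norm x" r]) (auto simp: \<Psi>_norm)
  qed
qed

end

text \<open>The order of choices matters: the fourth moment fixes \<open>C1\<close> through the first use of confinement, and
  only then the second use, with a constant depending on \<open>C1\<close>, determines how large the radius has to
  be. None of them depends on the flow.\<close>

lemma (in confining_force) uniform_support_bound:
  assumes "0 \<le> R0"
  shows "\<exists>R>0. \<forall>\<rho>. confining_flow G c A \<Lambda> R\<^sub>a \<rho> \<longrightarrow> (AE x in \<rho> 0. norm x \<le> R0) \<longrightarrow>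
      (\<forall>t\<ge>0. AE x in \<rho> t. norm x \<le> R)"
proof -
  obtain K0' where K0': "\<And>r. K0' \<le> r \<Longrightarrow> 6 * \<Lambda> * R\<^sub>a\<^sup>2 + 2 \<le> r\<^sup>2 * c r"
    using confining[of "6 * \<Lambda> * R\<^sub>a\<^sup>2 + 2"] by blast
  define K0 where "K0 = max (max K0' R\<^sub>a) 1"
  have K0: "0 < K0" "R\<^sub>a \<le> K0" "\<And>r. K0 \<le> r \<Longrightarrow> 6 * \<Lambda> * R\<^sub>a\<^sup>2 + 2 \<le> r\<^sup>2 * c r"
    using K0' by (auto simp: K0_def)
  define C0 where "C0 = (6 * \<Lambda> * R\<^sub>a\<^sup>2 + 2) / 4 * (2 * R0\<^sup>2 + K0\<^sup>2)"
  have C0: "0 \<le> C0" using \<Lambda>_nonneg by (simp add: C0_def)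
  define C1 where "C1 = 4 * C0 + 1"
  have C1: "0 \<le> C1" using C0 by (simp add: C1_def)
  obtain K where K: "\<And>r. K \<le> r \<Longrightarrow> 1440 * A * C1 \<le> r\<^sup>2 * c r"
    using confining[of "1440 * A * C1"] by blast
  define Rb where "Rb = 1 + R0 + R0\<^sup>2 + 32 * C1 + \<bar>2 * K\<bar>"
  have Rb: "1 \<le> Rb" "R0 \<le> Rb" "R0\<^sup>2 \<le> Rb" "32 * C1 \<le> Rb" "2 * K \<le> Rb"
    using assms C1 zero_le_power2[of R0] abs_ge_zero[of "2 * K"] abs_ge_self[of "2 * K"]
    unfolding Rb_def by argo+
  show ?thesis
  proof (intro exI[of _ "2 * Rb"] conjI allI impI)
    show "0 < 2 * Rb" using Rb by simp
    fix \<rho> t assume flow: "confining_flow G c A \<Lambda> R\<^sub>a \<rho>" and R0: "AE x in \<rho> 0. norm x \<le> R0" and t: "0 \<le> (t::real)"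
    interpret confining_flow G c A \<Lambda> R\<^sub>a \<rho> by (rule flow)
    have half: "\<forall>s. 0 \<le> s \<and> s \<le> t \<longrightarrow> (AE x in \<rho> s. norm x \<le> r)"
      if r: "Rb \<le> r" and supp: "\<forall>s. 0 \<le> s \<and> s \<le> t \<longrightarrow> (AE x in \<rho> s. norm x \<le> 2 * r)" for r
    proof (intro allI impI)
      have supp': "\<And>s. 0 \<le> s \<Longrightarrow> s \<le> t \<Longrightarrow> AE x in \<rho> s. norm x \<le> 2 * r" using supp by blast
      have r_sq: "r \<le> r\<^sup>2" using r Rb mult_left_mono[of 1 r r] by (simp add: power2_eq_square)
      have m4: "(\<integral>y. norm y ^ 4 \<partial>\<rho> s) \<le> C1 * r\<^sup>2" if "0 \<le> s" "s \<le> t" for s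
      proof -
        have "(\<integral>y. norm y ^ 4 \<partial>\<rho> s) \<le> max (R0 ^ 4) (C0 * (2 * r)\<^sup>2)"
          by (rule fourth_moment_bound[OF supp' R0 assms K0 C0_def that])
        also have "\<dots> \<le> C1 * r\<^sup>2"
        proof (rule max.boundedI)
          have "R0 ^ 4 = (R0\<^sup>2)\<^sup>2" by simp
          also have "\<dots> \<le> r\<^sup>2" using Rb r by (intro power_mono) auto
          also have "\<dots> \<le> C1 * r\<^sup>2" using C0 mult_right_mono[of 1 C1 "r\<^sup>2"] by (simp add: C1_def)
          finally show "R0 ^ 4 \<le> C1 * r\<^sup>2" .
          show "C0 * (2 * r)\<^sup>2 \<le> C1 * r\<^sup>2" by (simp add: C1_def power_mult_distrib distrib_right)
        qed
        finally show ?thesis .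
      qed
      fix s assume s: "0 \<le> s \<and> s \<le> t"
      show "AE x in \<rho> s. norm x \<le> r"
      proof (rule support_halving[OF supp' m4 C1 K])
        show "1 \<le> r" "2 * K \<le> r" "32 * C1 \<le> r\<^sup>2" using Rb r r_sq by auto
        show "AE x in \<rho> 0. norm x \<le> r" using R0 by eventually_elim (use Rb r in simp)
      qed (use s in auto)
    qed
    obtain S where S: "\<And>s. 0 \<le> s \<Longrightarrow> s \<le> t \<Longrightarrow> AE x in \<rho> s. norm x \<le> S"
      using finite_propagation[OF R0 t] by blast
    obtain n where n: "S / Rb < 2 ^ n" using real_arch_pow[of 2 "S / Rb"] by auto
    have "\<forall>s. 0 \<le> s \<and> s \<le> t \<longrightarrow> (AE x in \<rho> s. norm x \<le> 2 ^ n * Rb) \<Longrightarrow>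
        \<forall>s. 0 \<le> s \<and> s \<le> t \<longrightarrow> (AE x in \<rho> s. norm x \<le> Rb)"
    proof (induction n)
      case 0
      then show ?case by simp
    next
      case (Suc n)
      have "Rb \<le> 2 ^ n * Rb" using mult_right_mono[of 1 "2 ^ n" Rb] Rb by simp
      from half[OF this] Suc show ?case by (simp add: mult.assoc)
    qed
    moreover have "\<forall>s. 0 \<le> s \<and> s \<le> t \<longrightarrow> (AE x in \<rho> s. norm x \<le> 2 ^ n * Rb)"
    proof (intro allI impI)
      fix s assume s: "0 \<le> s \<and> s \<le> t"
      have "S \<le> 2 ^ n * Rb" using n Rb by (simp add: field_simps)
      moreover have "AE x in \<rho> s. norm x \<le> S" using S s by blast
      ultimately show "AE x in \<rho> s. norm x \<le> 2 ^ n * Rb" by (auto elim!: eventually_mono)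
    qed
    ultimately have "AE x in \<rho> t. norm x \<le> Rb" using t by blast
    then show "AE x in \<rho> t. norm x \<le> 2 * Rb" by eventually_elim (use Rb in simp)
  qed
qed

section \<open>Supports of measures\<close>

lemma AE_in_supp:
  assumes "\<mu> \<in> borel_prob"
  shows "AE x in \<mu>. x \<in> supp \<mu>"
proof -
  have s: "sets \<mu> = sets borel" using assms by (simp add: borel_prob_def)
  obtain B :: "'a set set" where B: "countable B" "topological_basis B"
    using ex_countable_basis by blast
  let ?N = "\<Union> {U \<in> B. emeasure \<mu> U = 0}"
  have op: "open U" if "U \<in> B" for U using topological_basis_open[OF B(2) that] .
  have "?N \<in> null_sets \<mu>"
  proof (rule null_sets_UN'[of "{U \<in> B. emeasure \<mu> U = 0}" "\<lambda>U. U", simplified])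
    show "countable {U \<in> B. emeasure \<mu> U = 0}" using B(1) by simp
    show "U \<in> null_sets \<mu>" if "U \<in> B \<and> emeasure \<mu> U = 0" for U
      using that op[of U] s by (auto intro: null_setsI)
  qed
  then have "AE x in \<mu>. x \<notin> ?N" by (rule AE_not_in)
  then show ?thesis
  proof (rule eventually_mono)
    fix x assume x: "x \<notin> ?N"
    show "x \<in> supp \<mu>"
      unfolding supp_def
    proof (intro CollectI allI impI)
      fix U assume U: "open U \<and> x \<in> U"
      then obtain V where V: "V \<in> B" "x \<in> V" "V \<subseteq> U"
        using topological_basisE[OF B(2)] by metis
      then have "0 < emeasure \<mu> V" using x by (auto simp: zero_less_iff_neq_zero)
      also have "\<dots> \<le> emeasure \<mu> U" using V U s by (intro emeasure_mono) auto
      finally show "0 < emeasure \<mu> U" .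
    qed
  qed
qed

lemma supp_subset_cball:
  assumes "sets \<mu> = sets borel" "AE x in \<mu>. norm x \<le> R"
  shows "supp \<mu> \<subseteq> cball 0 R"
proof
  fix x assume x: "x \<in> supp \<mu>"
  show "x \<in> cball 0 R"
  proof (rule ccontr)
    assume "x \<notin> cball 0 R"
    then have "0 < emeasure \<mu> (- cball 0 R)" using x open_Compl[OF closed_cball, of 0 R]
      by (auto simp: supp_def)
    moreover have "AE x in \<mu>. x \<notin> - cball 0 R" using assms(2) by eventually_elim simp
    then have "- cball 0 R \<in> null_sets \<mu>"
      using assms(1) by (subst (asm) AE_iff_null_sets[symmetric]) auto
    ultimately show False by (simp add: null_setsD1)
  qed
qed

theorem mainTheorem2:
  fixes W :: "real ^ 'n \<Rightarrow> real" and w :: "real \<Rightarrow> real" and \<rho>\<^sub>0 :: "(real ^ 'n) measure"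
  assumes "NL0 W" and "NL1 W" and "NL2 W" and "NL_RAD W w" and "NL_CONF w"
    and "\<rho>\<^sub>0 \<in> borel_prob" and "compact (supp \<rho>\<^sub>0)"
  shows "\<exists>R>0. \<forall>\<rho>. weak_solution W \<rho>\<^sub>0 \<rho> \<longrightarrow> (\<forall>t\<ge>0. supp (\<rho> t) \<subseteq> ball 0 R)"
proof -
  obtain c A \<Lambda> R\<^sub>a where "confining_force (force W) c A \<Lambda> R\<^sub>a"
    using confining_force_of_potential[OF assms(1-5)] .
  then interpret confining_force "force W" c A \<Lambda> R\<^sub>a .
  obtain R0 where R0: "0 < R0" "\<And>x. x \<in> supp \<rho>\<^sub>0 \<Longrightarrow> norm x \<le> R0"
    using compact_imp_bounded[OF assms(7)] bounded_pos by metis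
  have init: "AE x in \<rho>\<^sub>0. norm x \<le> R0"
    using AE_in_supp[OF assms(6)] by eventually_elim (rule R0(2))
  obtain R where R: "0 < R" and bound: "\<And>\<rho>. confining_flow (force W) c A \<Lambda> R\<^sub>a \<rho> \<Longrightarrow>
      AE x in \<rho> 0. norm x \<le> R0 \<Longrightarrow> \<forall>t\<ge>0. AE x in \<rho> t. norm x \<le> R"
    using uniform_support_bound[of R0] R0(1) by (auto simp: less_imp_le)
  have vel: "velocity W \<mu> = field \<mu>" for \<mu>
    by (simp add: fun_eq_iff velocity_eq_force field_def)
  show ?thesis
  proof (intro exI[of _ "R + 1"] conjI allI impI)
    show "0 < R + 1" using R by simp
    fix \<rho> t assume sol: "weak_solution W \<rho>\<^sub>0 \<rho>" and t: "0 \<le> (t :: real)"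
    have "locally_AC_curve \<rho>" "continuity_equation \<rho> (\<lambda>t. field (\<rho> t))" and 0: "\<rho> 0 = \<rho>\<^sub>0"
      using sol by (auto simp: weak_solution_def vel)
    then have flow: "confining_flow (force W) c A \<Lambda> R\<^sub>a \<rho>"
      by unfold_locales
    have "AE x in \<rho> t. norm x \<le> R" using bound[OF flow] init t unfolding 0 by blast
    then have "supp (\<rho> t) \<subseteq> cball 0 R"
      using P2D(2)[OF locally_AC_curve_P2[OF confining_flow.AC[OF flow] t]] by (intro supp_subset_cball)
    also have "\<dots> \<subseteq> ball 0 (R + 1)" by auto
    finally show "supp (\<rho> t) \<subseteq> ball 0 (R + 1)" .
  qed
qed

end
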